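(* Let $\phi \equiv \neg(\exists \bar x\,.\, \alpha \wedge \bigwedge_i \phi_i)$ with $\phi_i \equiv \neg(\exists \bar y_i\,.\,\beta_i)$ be a normal formula of depth at most 2 with free variables $\bar v$, and let $I$ be the output of the procedure FindInstantiation (described in the context) on $\bar v,\phi$. If $I$ is "none", then $\phi$ has no instantiable variable. Otherwise, let $u$ be the variable for which FindInstantiation returned; then $\phi$ is equivalent in the structure $\mathcal T$ of trees to the conjunction of normal formulae $\bigwedge_{(\exists \bar z\,.\,\psi)\in I} \neg(\exists \bar x\bar z\,.\,\alpha\wedge\psi\wedge\bigwedge_i\phi_i)$, in which $u$ is no longer instantiable.
   Context: Signature and trees: sorts $S$, generators $g: s_1\times\cdots\times s_n\to s$, $F_s$ the nonempty set of generators of $s$, every sort having at least two generators; predicates $\mathrm{fin}_s$. $\mathcal T$ interprets $s$ as the set of (possibly infinite) rooted ordered generator-labeled trees of sort $s$ (root labeled $g: s_1\times\cdots\times s_n\to s$, children in order of sorts $s_1,\dots,s_n$), generators as tree-building and $\mathrm{fin}$ as finiteness. $S_{FF}$ (resp. $S_{FI}$, $S_{1I}$) is the set of sorts with finitely many finite trees (resp. finitely many infinite trees, exactly one infinite tree). For $s\in S_{1I}$, $u_s$ is a variable for the unique infinite tree of $s$, and $U_s$ is a finite set of equations of the form $u_{s}=g(u_{s'})$, $s'\in S_{1I}$, that uniquely determines the $u$-variables. For $s\in S_{FF}$, $s_{\mathrm{fin}}$ is a finite set of ground terms denoting exactly the finite trees of sort $s$; for $s\in S_{FI}$, $s_{\mathrm{infin}}$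 is a finite set of terms over generators and variables $u_{s'}$ ($s'\in S_{1I}$) denoting exactly the infinite trees of sort $s$. Basic formula: $(\bigwedge_i v_i=t_i)\wedge(\bigwedge_j\mathrm{fin}(u_j))$ with each $t_i$ a variable or $g(\bar z)$, $\bar z$ variables. Solved w.r.t. a total order: all $v_i,u_j$ pairwise distinct, $x>y$ for each equation $x=y$ between variables, and $\mathrm{fin}(v)$ occurs only if the sort of $v$ has both finite and infinite trees. In a basic formula, $x_n$ is reachable from $x_0$ if it contains $x_0=t_0\wedge\cdots\wedge x_{n-1}=t_{n-1}$ with each $t_i$ containing $x_{i+1}$; properly reachable if $n>0$. A normal formula of depth $d\ge1$ is $\neg(\exists\bar x\,.\,\alpha\wedge\bigwedge_{i=1}^n\phi_i)$ with $\alpha$ basic and each $\phi_i$ normal of depth $d_i$, $d=1+\max(0,d_1,\dots,d_n)$. Instantiable variable: for $\phi$ as in the claim with $\alpha,\beta_i$ solved basic formulae, let $\beta_i^*$ be $\beta_i$ with all conjuncts also occurring in $\alpha$ removed. A variable $v:s$ free in $\phi$ or in $\bar x$ is instantiable if (1) $F_s$ is finite, some $\beta_i^*$ contains $v=g(\bar w)$ and $v$ is not properly reachable from $v$ in $\beta_i$; or (2) $s\in S_{FF}\cap S_{FI}$, some $\beta_i^*$ contains $v$, and $\alpha$ contains no equation $v=t$; or (3) $s\in S_{FF}$, $\alpha$ contains $\mathrm{fin}(v)$ and some $\beta_i^*$ contains $v$; or (4) $s\in S_{FI}$ and some $\beta_i^*$ contains only $\mathrm{fin}$-constraints, among them $\mathrm{fin}(v)$.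 FindInstantiation$(\bar v,\phi)$: for each variable $u:s$ in $\bar v\bar x$ in order, check the following in order and return at the first success: if $F_s$ is finite, $u=g(\bar z)$ occurs in some $\beta_i^*$ and $u$ is not properly reachable from $u$ in $\beta_i$, return $\{\exists\bar z\,.\,u=g'(\bar z)\mid g'\in F_s\}$ ($\bar z$ fresh); if $s\in S_{FF}\cap S_{FI}$, $u$ occurs in some $\beta_i^*$ and $\alpha$ contains no $u=t$, return $\{\exists u_{s_1},\dots,u_{s_n}\,.\,u=t\wedge\bigwedge_{s'\in S_{1I}}U_{s'}\mid t\in s_{\mathrm{fin}}\cup s_{\mathrm{infin}}\}$ where $S_{1I}=\{s_1,\dots,s_n\}$; if $s\in S_{FF}$, $u$ occurs in some $\beta_i^*$ and $\mathrm{fin}(u)$ occurs in $\alpha$, return $\{u=t\mid t\in s_{\mathrm{fin}}\}$; if $s\in S_{FI}$ and $\mathrm{fin}(u)$ occurs in some $\beta_i^*$ containing only $\mathrm{fin}$-constraints, return $\{\mathrm{fin}(u)\}\cup\{\exists u_{s_1},\dots,u_{s_n}\,.\,u=t\wedge\bigwedge_{s'\in S_{1I}}U_{s'}\mid t\in s_{\mathrm{infin}}\}$. If no variable succeeds, return "none". Each returned formula $u=t$ with nested $t$ is understood as an equivalent formula $\exists\bar z\,.\,\gamma$ with $\gamma$ a basic formula and $\bar z$ fresh (flattening $t$).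
   Formalization: "No longer instantiable" fails for the raw formulae (β_i is unchanged and may still contain u=g(w)); it is claimed after solving α∧ψ, adding what the result says about u to each β_i, re-solving and dropping unsatisfiable β_i. α and β_i are assumed solved, as the definitions presuppose. *)

theory Defs
  imports Main "HOL-Library.Multiset"
begin

section \<open>Trees\<close>

codatatype 'g tree = Node 'g "'g tree list"

inductive fin_tree :: "'g tree \<Rightarrow> bool" where
  "(\<forall>t \<in> set ts. fin_tree t) \<Longrightarrow> fin_tree (Node g ts)"

datatype ('g, 'v) trm = TVar 'v | TApp 'g "('g, 'v) trm list"

section \<open>Formulae\<close>

datatype ('g, 'v) rhs = Var 'v | App 'g "'v list"

datatype ('g, 'v) conjunct = Eq 'v "('g, 'v) rhs" | Fin 'v

text \<open>A basic formula is a conjunction, taken up to associativity and commutativity.\<close>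

type_synonym ('g, 'v) basic = "('g, 'v) conjunct multiset"

text \<open>\<open>NegEx xs \<alpha> \<phi>s\<close> is the normal formula
  \<open>\<not>(\<exists>xs. \<alpha> \<and> \<And>\<phi>s)\<close>.\<close>

datatype ('g, 'v) normal =
  NegEx (nvars: "'v list") (nbasic: "('g, 'v) basic") (nsubs: "('g, 'v) normal list")

fun depth :: "('g, 'v) normal \<Rightarrow> nat" where
  "depth (NegEx xs \<alpha> \<phi>s) = 1 + Max (insert 0 (depth ` set \<phi>s))"

fun rhs_vars :: "('g, 'v) rhs \<Rightarrow> 'v set" where
  "rhs_vars (Var y) = {y}"
| "rhs_vars (App g zs) = set zs"

fun subject :: "('g, 'v) conjunct \<Rightarrow> 'v" where
  "subject (Eq x t) = x"
| "subject (Fin x) = x"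

fun conjunct_vars :: "('g, 'v) conjunct \<Rightarrow> 'v set" where
  "conjunct_vars (Eq x t) = insert x (rhs_vars t)"
| "conjunct_vars (Fin x) = {x}"

definition basic_vars :: "('g, 'v) basic \<Rightarrow> 'v set" where
  "basic_vars \<Gamma> = (\<Union>c \<in> set_mset \<Gamma>. conjunct_vars c)"

fun free_vars :: "('g, 'v) normal \<Rightarrow> 'v set" where
  "free_vars (NegEx xs \<alpha> \<phi>s) = (basic_vars \<alpha> \<union> (\<Union>\<phi> \<in> set \<phi>s. free_vars \<phi>)) - set xs"

fun all_vars :: "('g, 'v) normal \<Rightarrow> 'v set" where
  "all_vars (NegEx xs \<alpha> \<phi>s) = set xs \<union> basic_vars \<alpha> \<union> (\<Union>\<phi> \<in> set \<phi>s. all_vars \<phi>)"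

fun trm_vars :: "('g, 'v) trm \<Rightarrow> 'v set" where
  "trm_vars (TVar v) = {v}"
| "trm_vars (TApp g ts) = (\<Union>t \<in> set ts. trm_vars t)"

section \<open>Signatures\<close>

text \<open>The sorts are the elements of the type \<open>'s\<close>. Besides the generators and the sorts of the
  variables, the record carries the auxiliary data used for instantiation: an enumeration
  \<open>one_inf\<close> of \<open>S\<^sub>1\<^sub>I\<close>, the variables \<open>u\<^sub>s\<close>, the equations \<open>U\<^sub>s\<close>, and the sets of terms
  \<open>s\<^sub>f\<^sub>i\<^sub>n\<close> and \<open>s\<^sub>i\<^sub>n\<^sub>f\<^sub>i\<^sub>n\<close>.\<close>

record ('s, 'g, 'v) signature =
  gen_args :: "'g \<Rightarrow> 's list"
  gen_sort :: "'g \<Rightarrow> 's"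
  var_sort :: "'v \<Rightarrow> 's"
  one_inf :: "'s list"
  uvar :: "'s \<Rightarrow> 'v"
  ueqs :: "'s \<Rightarrow> ('g, 'v) conjunct set"
  fin_terms :: "'s \<Rightarrow> ('g, 'v) trm set"
  inf_terms :: "'s \<Rightarrow> ('g, 'v) trm set"

definition gens :: "('s, 'g, 'v) signature \<Rightarrow> 's \<Rightarrow> 'g set" where
  "gens \<Sigma> s = {g. gen_sort \<Sigma> g = s}"

coinductive tree_of_sort :: "('s, 'g, 'v) signature \<Rightarrow> 's \<Rightarrow> 'g tree \<Rightarrow> bool"
  for \<Sigma> where
  "list_all2 (tree_of_sort \<Sigma>) (gen_args \<Sigma> g) ts \<Longrightarrow> tree_of_sort \<Sigma> (gen_sort \<Sigma> g) (Node g ts)"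

definition fin_trees :: "('s, 'g, 'v) signature \<Rightarrow> 's \<Rightarrow> 'g tree set" where
  "fin_trees \<Sigma> s = {t. tree_of_sort \<Sigma> s t \<and> fin_tree t}"

definition inf_trees :: "('s, 'g, 'v) signature \<Rightarrow> 's \<Rightarrow> 'g tree set" where
  "inf_trees \<Sigma> s = {t. tree_of_sort \<Sigma> s t \<and> \<not> fin_tree t}"

definition S_FF :: "('s, 'g, 'v) signature \<Rightarrow> 's set" where
  "S_FF \<Sigma> = {s. finite (fin_trees \<Sigma> s)}"

definition S_FI :: "('s, 'g, 'v) signature \<Rightarrow> 's set" where
  "S_FI \<Sigma> = {s. finite (inf_trees \<Sigma> s)}"

definition S_1I :: "('s, 'g, 'v) signature \<Rightarrow> 's set" where
  "S_1I \<Sigma> = {s. \<exists>!t. t \<in> inf_trees \<Sigma> s}"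

inductive trm_of_sort :: "('s, 'g, 'v) signature \<Rightarrow> 's \<Rightarrow> ('g, 'v) trm \<Rightarrow> bool"
  for \<Sigma> where
  "trm_of_sort \<Sigma> (var_sort \<Sigma> v) (TVar v)"
| "list_all2 (trm_of_sort \<Sigma>) (gen_args \<Sigma> g) ts \<Longrightarrow> trm_of_sort \<Sigma> (gen_sort \<Sigma> g) (TApp g ts)"

fun well_sorted_conjunct :: "('s, 'g, 'v) signature \<Rightarrow> ('g, 'v) conjunct \<Rightarrow> bool" where
  "well_sorted_conjunct \<Sigma> (Eq x (Var y)) \<longleftrightarrow> var_sort \<Sigma> x = var_sort \<Sigma> y"
| "well_sorted_conjunct \<Sigma> (Eq x (App g zs)) \<longleftrightarrow>
     var_sort \<Sigma> x = gen_sort \<Sigma> g \<and> map (var_sort \<Sigma>) zs = gen_args \<Sigma> g"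
| "well_sorted_conjunct \<Sigma> (Fin x) \<longleftrightarrow> True"

definition well_sorted_basic :: "('s, 'g, 'v) signature \<Rightarrow> ('g, 'v) basic \<Rightarrow> bool" where
  "well_sorted_basic \<Sigma> \<Gamma> \<longleftrightarrow> (\<forall>c \<in># \<Gamma>. well_sorted_conjunct \<Sigma> c)"

fun well_sorted :: "('s, 'g, 'v) signature \<Rightarrow> ('g, 'v) normal \<Rightarrow> bool" where
  "well_sorted \<Sigma> (NegEx xs \<alpha> \<phi>s) \<longleftrightarrow>
     well_sorted_basic \<Sigma> \<alpha> \<and> (\<forall>\<phi> \<in> set \<phi>s. well_sorted \<Sigma> \<phi>)"

section \<open>Semantics in the structure of trees\<close>

definition valuation :: "('s, 'g, 'v) signature \<Rightarrow> ('v \<Rightarrow> 'g tree) \<Rightarrow> bool" where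
  "valuation \<Sigma> \<rho> \<longleftrightarrow> (\<forall>v. tree_of_sort \<Sigma> (var_sort \<Sigma> v) (\<rho> v))"

fun trm_val :: "('v \<Rightarrow> 'g tree) \<Rightarrow> ('g, 'v) trm \<Rightarrow> 'g tree" where
  "trm_val \<rho> (TVar v) = \<rho> v"
| "trm_val \<rho> (TApp g ts) = Node g (map (trm_val \<rho>) ts)"

fun holds :: "('v \<Rightarrow> 'g tree) \<Rightarrow> ('g, 'v) conjunct \<Rightarrow> bool" where
  "holds \<rho> (Eq x (Var y)) \<longleftrightarrow> \<rho> x = \<rho> y"
| "holds \<rho> (Eq x (App g zs)) \<longleftrightarrow> \<rho> x = Node g (map \<rho> zs)"
| "holds \<rho> (Fin x) \<longleftrightarrow> fin_tree (\<rho> x)"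

fun models :: "('s, 'g, 'v) signature \<Rightarrow> ('v \<Rightarrow> 'g tree) \<Rightarrow> ('g, 'v) normal \<Rightarrow> bool" where
  "models \<Sigma> \<rho> (NegEx xs \<alpha> \<phi>s) \<longleftrightarrow>
     \<not> (\<exists>\<rho>'. valuation \<Sigma> \<rho>' \<and> (\<forall>v. v \<notin> set xs \<longrightarrow> \<rho>' v = \<rho> v) \<and>
          (\<forall>c \<in># \<alpha>. holds \<rho>' c) \<and> (\<forall>\<phi> \<in> set \<phi>s. models \<Sigma> \<rho>' \<phi>))"

text \<open>The variables \<open>u\<^sub>s\<close> are determined by the equations in all the \<open>U\<^sub>s\<close> together. On sorts outside
  \<open>S\<^sub>1\<^sub>I\<close>, \<open>S\<^sub>F\<^sub>F\<close> and \<open>S\<^sub>F\<^sub>I\<close>, respectively, the auxiliary data are arbitrary.\<close>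

definition admissible :: "('s, 'g, 'v) signature \<Rightarrow> bool" where
  "admissible \<Sigma> \<longleftrightarrow>
     (\<forall>s. \<exists>g h. g \<noteq> h \<and> g \<in> gens \<Sigma> s \<and> h \<in> gens \<Sigma> s) \<and>
     distinct (one_inf \<Sigma>) \<and> set (one_inf \<Sigma>) = S_1I \<Sigma> \<and>
     (\<forall>s \<in> S_1I \<Sigma>. var_sort \<Sigma> (uvar \<Sigma> s) = s) \<and>
     (\<forall>s \<in> S_1I \<Sigma>. finite (ueqs \<Sigma> s) \<and>
        (\<forall>c \<in> ueqs \<Sigma> s. well_sorted_conjunct \<Sigma> c \<and>
           (\<exists>r \<in> S_1I \<Sigma>. \<exists>g. \<exists>r' \<in> S_1I \<Sigma>. c = Eq (uvar \<Sigma> r) (App g [uvar \<Sigma> r'])))) \<and>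
     (\<forall>\<rho>. valuation \<Sigma> \<rho> \<longrightarrow>
        ((\<forall>s \<in> S_1I \<Sigma>. \<forall>c \<in> ueqs \<Sigma> s. holds \<rho> c) \<longleftrightarrow>
         (\<forall>s \<in> S_1I \<Sigma>. \<rho> (uvar \<Sigma> s) \<in> inf_trees \<Sigma> s))) \<and>
     (\<forall>s \<in> S_FF \<Sigma>. finite (fin_terms \<Sigma> s) \<and>
        (\<forall>t \<in> fin_terms \<Sigma> s. trm_of_sort \<Sigma> s t \<and> trm_vars t = {}) \<and>
        (\<forall>\<rho>. valuation \<Sigma> \<rho> \<longrightarrow> trm_val \<rho> ` fin_terms \<Sigma> s = fin_trees \<Sigma> s)) \<and>
     (\<forall>s \<in> S_FI \<Sigma>. finite (inf_terms \<Sigma> s) \<and>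
        (\<forall>t \<in> inf_terms \<Sigma> s. trm_of_sort \<Sigma> s t \<and> trm_vars t \<subseteq> uvar \<Sigma> ` S_1I \<Sigma>) \<and>
        (\<forall>\<rho>. valuation \<Sigma> \<rho> \<and> (\<forall>r \<in> S_1I \<Sigma>. \<rho> (uvar \<Sigma> r) \<in> inf_trees \<Sigma> r) \<longrightarrow>
           trm_val \<rho> ` inf_terms \<Sigma> s = inf_trees \<Sigma> s))"

section \<open>Solved basic formulae and reachability\<close>

text \<open>The total order on the variables is that of the type class \<open>linorder\<close>.\<close>

definition solved :: "('s, 'g, 'v::linorder) signature \<Rightarrow> ('g, 'v) basic \<Rightarrow> bool" where
  "solved \<Sigma> \<Gamma> \<longleftrightarrow>
     (\<forall>x. size {# c \<in># \<Gamma>. subject c = x #} \<le> 1) \<and>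
     (\<forall>x y. Eq x (Var y) \<in># \<Gamma> \<longrightarrow> x > y) \<and>
     (\<forall>x. Fin x \<in># \<Gamma> \<longrightarrow>
        fin_trees \<Sigma> (var_sort \<Sigma> x) \<noteq> {} \<and> inf_trees \<Sigma> (var_sort \<Sigma> x) \<noteq> {})"

definition edges :: "('g, 'v) basic \<Rightarrow> ('v \<times> 'v) set" where
  "edges \<Gamma> = {(x, y). \<exists>t. Eq x t \<in># \<Gamma> \<and> y \<in> rhs_vars t}"

definition reachable :: "('g, 'v) basic \<Rightarrow> 'v \<Rightarrow> 'v \<Rightarrow> bool" where
  "reachable \<Gamma> x y \<longleftrightarrow> (x, y) \<in> (edges \<Gamma>)\<^sup>*"

definition properly_reachable :: "('g, 'v) basic \<Rightarrow> 'v \<Rightarrow> 'v \<Rightarrow> bool" where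
  "properly_reachable \<Gamma> x y \<longleftrightarrow> (x, y) \<in> (edges \<Gamma>)\<^sup>+"

section \<open>Instantiable variables\<close>

definition star :: "('g, 'v) basic \<Rightarrow> ('g, 'v) basic \<Rightarrow> ('g, 'v) basic" where
  "star \<alpha> \<beta> = {# c \<in># \<beta>. c \<notin># \<alpha> #}"

definition inst_gen :: "('s, 'g, 'v) signature \<Rightarrow> ('g, 'v) normal \<Rightarrow> 'v \<Rightarrow> bool" where
  "inst_gen \<Sigma> \<phi> v \<longleftrightarrow> finite (gens \<Sigma> (var_sort \<Sigma> v)) \<and>
     (\<exists>\<chi> \<in> set (nsubs \<phi>). (\<exists>g ws. Eq v (App g ws) \<in># star (nbasic \<phi>) (nbasic \<chi>)) \<and>
        \<not> properly_reachable (nbasic \<chi>) v v)"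

definition inst_all :: "('s, 'g, 'v) signature \<Rightarrow> ('g, 'v) normal \<Rightarrow> 'v \<Rightarrow> bool" where
  "inst_all \<Sigma> \<phi> v \<longleftrightarrow> var_sort \<Sigma> v \<in> S_FF \<Sigma> \<inter> S_FI \<Sigma> \<and>
     (\<exists>\<chi> \<in> set (nsubs \<phi>). v \<in> basic_vars (star (nbasic \<phi>) (nbasic \<chi>))) \<and>
     (\<nexists>t. Eq v t \<in># nbasic \<phi>)"

definition inst_fin :: "('s, 'g, 'v) signature \<Rightarrow> ('g, 'v) normal \<Rightarrow> 'v \<Rightarrow> bool" where
  "inst_fin \<Sigma> \<phi> v \<longleftrightarrow> var_sort \<Sigma> v \<in> S_FF \<Sigma> \<and> Fin v \<in># nbasic \<phi> \<and>
     (\<exists>\<chi> \<in> set (nsubs \<phi>). v \<in> basic_vars (star (nbasic \<phi>) (nbasic \<chi>)))"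

definition inst_inf :: "('s, 'g, 'v) signature \<Rightarrow> ('g, 'v) normal \<Rightarrow> 'v \<Rightarrow> bool" where
  "inst_inf \<Sigma> \<phi> v \<longleftrightarrow> var_sort \<Sigma> v \<in> S_FI \<Sigma> \<and>
     (\<exists>\<chi> \<in> set (nsubs \<phi>). (\<forall>c \<in># star (nbasic \<phi>) (nbasic \<chi>). \<exists>x. c = Fin x) \<and>
        Fin v \<in># star (nbasic \<phi>) (nbasic \<chi>))"

definition instantiable :: "('s, 'g, 'v) signature \<Rightarrow> ('g, 'v) normal \<Rightarrow> 'v \<Rightarrow> bool" where
  "instantiable \<Sigma> \<phi> v \<longleftrightarrow> v \<in> free_vars \<phi> \<union> set (nvars \<phi>) \<and>
     (inst_gen \<Sigma> \<phi> v \<or> inst_all \<Sigma> \<phi> v \<or> inst_fin \<Sigma> \<phi> v \<or> inst_inf \<Sigma> \<phi> v)"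

section \<open>The procedure FindInstantiation\<close>

text \<open>\<open>flat u t zs \<Gamma>\<close>: the equation \<open>u = t\<close> is flattened to \<open>\<exists>zs. \<Gamma>\<close>, where \<open>zs\<close> names the proper
  subterms of \<open>t\<close> that are not variables.\<close>

inductive flat :: "'v \<Rightarrow> ('g, 'v) trm \<Rightarrow> 'v list \<Rightarrow> ('g, 'v) basic \<Rightarrow> bool"
  and flat_args :: "'v list \<Rightarrow> ('g, 'v) trm list \<Rightarrow> 'v list \<Rightarrow> ('g, 'v) basic \<Rightarrow> bool" where
  "flat u (TVar w) [] {# Eq u (Var w) #}"
| "flat_args ws ts zs \<Gamma> \<Longrightarrow> flat u (TApp g ts) zs (add_mset (Eq u (App g ws)) \<Gamma>)"
| "flat_args [] [] [] {#}"
| "flat_args ws ts zs \<Gamma> \<Longrightarrow> flat_args (w # ws) (TVar w # ts) zs \<Gamma>"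
| "flat z (TApp g rs) zs \<Gamma> \<Longrightarrow> flat_args ws ts zs' \<Gamma>' \<Longrightarrow>
     flat_args (z # ws) (TApp g rs # ts) (z # zs @ zs') (\<Gamma> + \<Gamma>')"

text \<open>The choice of fresh variables is a parameter: \<open>fz g\<close> supplies the arguments of the
  generator \<open>g\<close>, and \<open>fl u t\<close> is a flattening of \<open>u = t\<close>.\<close>

definition fresh_choice ::
    "('s, 'g, 'v) signature \<Rightarrow> ('g, 'v) normal \<Rightarrow> ('g \<Rightarrow> 'v list) \<Rightarrow>
     ('v \<Rightarrow> ('g, 'v) trm \<Rightarrow> 'v list \<times> ('g, 'v) basic) \<Rightarrow> bool" where
  "fresh_choice \<Sigma> \<phi> fz fl \<longleftrightarrow>
     (\<forall>g. distinct (fz g) \<and> map (var_sort \<Sigma>) (fz g) = gen_args \<Sigma> g \<and>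
        set (fz g) \<inter> all_vars \<phi> = {}) \<and>
     (\<forall>u t zs \<Gamma>. u \<in> all_vars \<phi> \<and> trm_of_sort \<Sigma> (var_sort \<Sigma> u) t \<and> fl u t = (zs, \<Gamma>) \<longrightarrow>
        flat u t zs \<Gamma> \<and> well_sorted_basic \<Sigma> \<Gamma> \<and> distinct zs \<and>
        set zs \<inter> (all_vars \<phi> \<union> trm_vars t \<union> uvar \<Sigma> ` S_1I \<Sigma>) = {})"

text \<open>A pair \<open>(zs, \<psi>)\<close> stands for the formula \<open>\<exists>zs. \<psi>\<close>.\<close>

definition with_ueqs ::
    "('s, 'g, 'v) signature \<Rightarrow> 'v list \<times> ('g, 'v) basic \<Rightarrow> 'v list \<times> ('g, 'v) basic" where
  "with_ueqs \<Sigma> = (\<lambda>(zs, \<Gamma>).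
     (map (uvar \<Sigma>) (one_inf \<Sigma>) @ zs, \<Gamma> + (\<Sum>s \<leftarrow> one_inf \<Sigma>. mset_set (ueqs \<Sigma> s))))"

fun find_inst_in ::
    "('s, 'g, 'v) signature \<Rightarrow> ('g \<Rightarrow> 'v list) \<Rightarrow>
     ('v \<Rightarrow> ('g, 'v) trm \<Rightarrow> 'v list \<times> ('g, 'v) basic) \<Rightarrow>
     ('g, 'v) normal \<Rightarrow> 'v list \<Rightarrow> ('v \<times> ('v list \<times> ('g, 'v) basic) set) option" where
  "find_inst_in \<Sigma> fz fl \<phi> [] = None"
| "find_inst_in \<Sigma> fz fl \<phi> (u # us) =
     (let s = var_sort \<Sigma> u in
      if inst_gen \<Sigma> \<phi> u then
        Some (u, (\<lambda>g. (fz g, {# Eq u (App g (fz g)) #})) ` gens \<Sigma> s)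
      else if inst_all \<Sigma> \<phi> u then
        Some (u, (\<lambda>t. with_ueqs \<Sigma> (fl u t)) ` (fin_terms \<Sigma> s \<union> inf_terms \<Sigma> s))
      else if inst_fin \<Sigma> \<phi> u then
        Some (u, fl u ` fin_terms \<Sigma> s)
      else if inst_inf \<Sigma> \<phi> u then
        Some (u, insert ([], {# Fin u #}) ((\<lambda>t. with_ueqs \<Sigma> (fl u t)) ` inf_terms \<Sigma> s))
      else find_inst_in \<Sigma> fz fl \<phi> us)"

definition find_instantiation ::
    "('s, 'g, 'v) signature \<Rightarrow> ('g \<Rightarrow> 'v list) \<Rightarrow>
     ('v \<Rightarrow> ('g, 'v) trm \<Rightarrow> 'v list \<times> ('g, 'v) basic) \<Rightarrow>
     'v list \<Rightarrow> ('g, 'v) normal \<Rightarrow> ('v \<times> ('v list \<times> ('g, 'v) basic) set) option" where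
  "find_instantiation \<Sigma> fz fl vs \<phi> = find_inst_in \<Sigma> fz fl \<phi> (vs @ nvars \<phi>)"

definition instantiate ::
    "('g, 'v) normal \<Rightarrow> 'v list \<times> ('g, 'v) basic \<Rightarrow> ('g, 'v) normal" where
  "instantiate \<phi> = (\<lambda>(zs, \<psi>). NegEx (nvars \<phi> @ zs) (nbasic \<phi> + \<psi>) (nsubs \<phi>))"

section \<open>Solving the instantiated formulae\<close>

text \<open>Instantiability presupposes solved basic formulae, whereas \<open>\<alpha> \<and> \<psi>\<close> need not be solved and
  the \<open>\<beta>\<^sub>i\<close> do not take \<open>\<psi>\<close> into account yet. The usual unification rules for rational trees,
  extended to finiteness constraints, bring a basic formula into solved form. The set \<open>A\<close> holds
  the conjuncts of the surrounding formula: of two equations \<open>x = g(zs)\<close> and \<open>x = g(ws)\<close>, one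
  that occurs in the surrounding formula is kept.\<close>

inductive solve_step ::
    "('s, 'g, 'v::linorder) signature \<Rightarrow> ('g, 'v) conjunct set \<Rightarrow>
     ('g, 'v) basic \<Rightarrow> ('g, 'v) basic \<Rightarrow> bool" for \<Sigma> A where
  trivial: "solve_step \<Sigma> A ({# Eq x (Var x) #} + \<Gamma>) \<Gamma>"
| orient: "x < y \<Longrightarrow> solve_step \<Sigma> A ({# Eq x (Var y) #} + \<Gamma>) ({# Eq y (Var x) #} + \<Gamma>)"
| replace: "x > y \<Longrightarrow>
     solve_step \<Sigma> A ({# Eq x (Var y), Eq x t #} + \<Gamma>) ({# Eq x (Var y), Eq y t #} + \<Gamma>)"
| decompose: "(Eq x (App g ws) \<in> A \<Longrightarrow> Eq x (App g zs) \<in> A) \<Longrightarrow>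
     solve_step \<Sigma> A ({# Eq x (App g zs), Eq x (App g ws) #} + \<Gamma>)
       ({# Eq x (App g zs) #} + mset (map2 (\<lambda>z w. Eq z (Var w)) zs ws) + \<Gamma>)"
| fin_replace: "x > y \<Longrightarrow>
     solve_step \<Sigma> A ({# Eq x (Var y), Fin x #} + \<Gamma>) ({# Eq x (Var y), Fin y #} + \<Gamma>)"
| fin_decompose: "\<not> properly_reachable ({# Eq x (App g zs) #} + \<Gamma>) x x \<Longrightarrow>
     solve_step \<Sigma> A ({# Eq x (App g zs), Fin x #} + \<Gamma>)
       ({# Eq x (App g zs) #} + mset (map Fin zs) + \<Gamma>)"
| fin_duplicate: "solve_step \<Sigma> A ({# Fin x, Fin x #} + \<Gamma>) ({# Fin x #} + \<Gamma>)"
| fin_trivial: "inf_trees \<Sigma> (var_sort \<Sigma> x) = {} \<Longrightarrow> solve_step \<Sigma> A ({# Fin x #} + \<Gamma>) \<Gamma>"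

definition clash :: "('s, 'g, 'v) signature \<Rightarrow> ('g, 'v) basic \<Rightarrow> bool" where
  "clash \<Sigma> \<Gamma> \<longleftrightarrow>
     (\<exists>x g zs h ws. Eq x (App g zs) \<in># \<Gamma> \<and> Eq x (App h ws) \<in># \<Gamma> \<and> g \<noteq> h) \<or>
     (\<exists>x g zs. Eq x (App g zs) \<in># \<Gamma> \<and> Fin x \<in># \<Gamma> \<and> properly_reachable \<Gamma> x x) \<or>
     (\<exists>x. Fin x \<in># \<Gamma> \<and> fin_trees \<Sigma> (var_sort \<Sigma> x) = {})"

definition solves_to ::
    "('s, 'g, 'v::linorder) signature \<Rightarrow> ('g, 'v) conjunct set \<Rightarrow>
     ('g, 'v) basic \<Rightarrow> ('g, 'v) basic \<Rightarrow> bool" where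
  "solves_to \<Sigma> A \<Gamma> \<Gamma>' \<longleftrightarrow> (solve_step \<Sigma> A)\<^sup>*\<^sup>* \<Gamma> \<Gamma>' \<and> solved \<Sigma> \<Gamma>'"

definition solving_fails ::
    "('s, 'g, 'v::linorder) signature \<Rightarrow> ('g, 'v) conjunct set \<Rightarrow> ('g, 'v) basic \<Rightarrow> bool" where
  "solving_fails \<Sigma> A \<Gamma> \<longleftrightarrow> (\<exists>\<Gamma>'. (solve_step \<Sigma> A)\<^sup>*\<^sup>* \<Gamma> \<Gamma>' \<and> clash \<Sigma> \<Gamma>')"

definition about :: "'v \<Rightarrow> ('g, 'v) basic \<Rightarrow> ('g, 'v) basic" where
  "about u \<alpha> = {# c \<in># \<alpha>. reachable \<alpha> u (subject c) #}"

text \<open>What \<open>\<alpha>\<close> says about \<open>u\<close> is added to every \<open>\<beta>\<^sub>i\<close>, which leaves the whole formula equivalent;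
  a subformula whose \<open>\<beta>\<^sub>i\<close> becomes unsatisfiable is true and is dropped.\<close>

inductive solved_subs ::
    "('s, 'g, 'v::linorder) signature \<Rightarrow> 'v \<Rightarrow> ('g, 'v) basic \<Rightarrow>
     ('g, 'v) normal list \<Rightarrow> ('g, 'v) normal list \<Rightarrow> bool" for \<Sigma> u \<alpha> where
  "solved_subs \<Sigma> u \<alpha> [] []"
| "solves_to \<Sigma> (set_mset \<alpha>) (about u \<alpha> + \<beta>) \<beta>' \<Longrightarrow> solved_subs \<Sigma> u \<alpha> \<phi>s \<phi>s' \<Longrightarrow>
     solved_subs \<Sigma> u \<alpha> (NegEx ys \<beta> \<chi>s # \<phi>s) (NegEx ys \<beta>' \<chi>s # \<phi>s')"
| "solving_fails \<Sigma> (set_mset \<alpha>) (about u \<alpha> + \<beta>) \<Longrightarrow> solved_subs \<Sigma> u \<alpha> \<phi>s \<phi>s' \<Longrightarrow>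
     solved_subs \<Sigma> u \<alpha> (NegEx ys \<beta> \<chi>s # \<phi>s) \<phi>s'"

inductive solved_form ::
    "('s, 'g, 'v::linorder) signature \<Rightarrow> 'v \<Rightarrow> ('g, 'v) normal \<Rightarrow> ('g, 'v) normal \<Rightarrow> bool"
  for \<Sigma> u where
  "solves_to \<Sigma> {} \<alpha> \<alpha>' \<Longrightarrow> solved_subs \<Sigma> u \<alpha>' \<phi>s \<phi>s' \<Longrightarrow>
     solved_form \<Sigma> u (NegEx xs \<alpha> \<phi>s) (NegEx xs \<alpha>' \<phi>s')"

text \<open>If solving \<open>\<alpha>\<close> fails, the formula is equivalent to true and has no solved form. The second
  conjunct ensures that in all other cases there is a solved form.\<close>

definition no_longer_instantiable ::
    "('s, 'g, 'v::linorder) signature \<Rightarrow> 'v \<Rightarrow> ('g, 'v) normal \<Rightarrow> bool" where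
  "no_longer_instantiable \<Sigma> u \<phi> \<longleftrightarrow>
     (\<forall>\<phi>'. solved_form \<Sigma> u \<phi> \<phi>' \<longrightarrow> \<not> instantiable \<Sigma> \<phi>' u) \<and>
     (solving_fails \<Sigma> {} (nbasic \<phi>) \<or> (\<exists>\<phi>'. solved_form \<Sigma> u \<phi> \<phi>'))"

end

theory Submission
  imports Defs
begin

text \<open>
  \<^bold>\<open>Equivalence.\<close> The bound variables of the instances are fresh, so a solution of an instance
  restricts to a solution of the original formula. Conversely the instances exhaust the possible
  values of \<open>u\<close> that are compatible with \<open>\<alpha>\<close>.

  \<^bold>\<open>Instantiability.\<close> Solving merges classes of variables and never loses the information that
  the class of \<open>u\<close> contains a smaller variable or a variable with an equation \<open>w = g(zs)\<close>. A
  solved formula with this property has an equation for \<open>u\<close>. All instances except \<open>fin(u)\<close> have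
  the property, by themselves and hence after their equations for \<open>u\<close> are added to the
  \<open>\<beta>\<^sub>i\<close>; moreover an equation \<open>u = g(zs)\<close> of \<open>\<alpha>\<close> survives in the solved \<open>\<beta>\<^sub>i\<close>. This rules out
  all four kinds of instantiability. For the instance \<open>fin(u)\<close> with no equation for \<open>u\<close> in
  \<open>\<alpha>\<close>, the formula \<open>\<alpha> \<and> fin(u)\<close> is already solved, and the claim follows from the failure of
  the kinds that are tried first: if \<open>\<beta>\<^sub>i\<close> has an equation \<open>u = g(zs)\<close>, then \<open>u\<close> lies on a cycle of
  \<open>\<beta>\<^sub>i\<close>, which contradicts \<open>fin(u)\<close>.

  \<^bold>\<open>Existence of solved forms.\<close> The equations are solved first; afterwards the finiteness
  constraints are pushed along the edges of the resulting graph.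
\<close>

section \<open>Valuations and instantiation\<close>

lemma holds_cong:
  "(\<And>v. v \<in> conjunct_vars c \<Longrightarrow> \<rho> v = \<rho>' v) \<Longrightarrow> holds \<rho> c \<longleftrightarrow> holds \<rho>' c"
  by (induction \<rho> c rule: holds.induct) (auto cong: map_cong)

lemma holds_basic_cong:
  assumes "\<And>v. v \<in> basic_vars \<Gamma> \<Longrightarrow> \<rho> v = \<rho>' v"
  shows "(\<forall>c \<in># \<Gamma>. holds \<rho> c) \<longleftrightarrow> (\<forall>c \<in># \<Gamma>. holds \<rho>' c)"
proof (intro ball_cong refl holds_cong assms)
  fix c v assume "c \<in># \<Gamma>" "v \<in> conjunct_vars c"
  then show "v \<in> basic_vars \<Gamma>" by (auto simp: basic_vars_def)
qed

text \<open>An implication suffices because the hypotheses are symmetric. The negation in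
  \<open>NegEx\<close> swaps the two valuations at every level, so the induction generalises over
  both.\<close>

lemma models_cong:
  assumes "valuation \<Sigma> \<rho>" "valuation \<Sigma> \<rho>'" "\<And>v. v \<in> free_vars \<phi> \<Longrightarrow> \<rho> v = \<rho>' v"
    and "models \<Sigma> \<rho> \<phi>"
  shows "models \<Sigma> \<rho>' \<phi>"
  using assms
proof (induction \<phi> arbitrary: \<rho> \<rho>')
  case (NegEx xs \<alpha> \<phi>s)
  show ?case
  proof (rule ccontr)
    assume "\<not> models \<Sigma> \<rho>' (NegEx xs \<alpha> \<phi>s)"
    then obtain \<sigma>' where \<sigma>': "valuation \<Sigma> \<sigma>'" "\<And>v. v \<notin> set xs \<Longrightarrow> \<sigma>' v = \<rho>' v"
      "\<forall>c \<in># \<alpha>. holds \<sigma>' c" "\<And>\<phi>. \<phi> \<in> set \<phi>s \<Longrightarrow> models \<Sigma> \<sigma>' \<phi>"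
      by auto
    \<comment> \<open>The refuting witness for \<open>\<rho>'\<close> is carried over to
      \<open>\<rho>\<close>: its values are kept on the bound variables and replaced by those of
      \<open>\<rho>\<close> elsewhere.\<close>
    define \<sigma> where "\<sigma> = (\<lambda>v. if v \<in> set xs then \<sigma>' v else \<rho> v)"
    have val: "valuation \<Sigma> \<sigma>"
      using NegEx.prems(1) \<sigma>'(1) by (auto simp: valuation_def \<sigma>_def)
    have eq: "\<sigma>' v = \<sigma> v" if "v \<in> basic_vars \<alpha> \<union> (\<Union>\<phi> \<in> set \<phi>s. free_vars \<phi>)" for v
      using that NegEx.prems(3)[of v] \<sigma>'(2)[of v] by (auto simp: \<sigma>_def)
    have "\<forall>c \<in># \<alpha>. holds \<sigma> c"
      using \<sigma>'(3) holds_basic_cong[of \<alpha> \<sigma>' \<sigma>] eq by blast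
    moreover have "models \<Sigma> \<sigma> \<phi>" if "\<phi> \<in> set \<phi>s" for \<phi>
      using that by (intro NegEx.IH[OF that \<sigma>'(1) val _ \<sigma>'(4)[OF that]] eq) auto
    ultimately show False
      using NegEx.prems(4) val by (auto simp: \<sigma>_def)
  qed
qed

lemma free_vars_subset_all_vars: "free_vars \<phi> \<subseteq> all_vars \<phi>"
  by (induction \<phi>) fastforce

text \<open>By \<open>fresh\<close>, changing the values of \<open>zs\<close> affects neither
  \<alpha> nor the subformulae. By \<open>cover\<close>, every solution of \<alpha> becomes a
  solution of some instance after such a change. So witnesses can be moved in both
  directions.\<close>

lemma models_instantiate_iff:
  assumes val: "valuation \<Sigma> \<rho>"
    and fresh: "\<And>zs \<psi>. (zs, \<psi>) \<in> I \<Longrightarrow> set zs \<inter> all_vars \<phi> = {}"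
    and cover: "\<And>\<sigma>. \<lbrakk>valuation \<Sigma> \<sigma>; \<forall>c \<in># nbasic \<phi>. holds \<sigma> c\<rbrakk> \<Longrightarrow>
      \<exists>zs \<psi> \<sigma>'. (zs, \<psi>) \<in> I \<and> valuation \<Sigma> \<sigma>' \<and> (\<forall>v. v \<notin> set zs \<longrightarrow> \<sigma>' v = \<sigma> v) \<and>
        (\<forall>c \<in># \<psi>. holds \<sigma>' c)"
  shows "models \<Sigma> \<rho> \<phi> \<longleftrightarrow> (\<forall>\<psi> \<in> I. models \<Sigma> \<rho> (instantiate \<phi> \<psi>))"
proof -
  obtain xs \<alpha> \<phi>s where \<phi>: "\<phi> = NegEx xs \<alpha> \<phi>s" by (cases \<phi>)
  have transfer: "(\<forall>c \<in># \<alpha>. holds \<sigma>' c) \<and> (\<forall>\<chi> \<in> set \<phi>s. models \<Sigma> \<sigma>' \<chi>)"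
    if "valuation \<Sigma> \<sigma>" "valuation \<Sigma> \<sigma>'" "(zs, \<psi>) \<in> I" "\<And>v. v \<notin> set zs \<Longrightarrow> \<sigma>' v = \<sigma> v"
      "\<forall>c \<in># \<alpha>. holds \<sigma> c" "\<forall>\<chi> \<in> set \<phi>s. models \<Sigma> \<sigma> \<chi>" for \<sigma> \<sigma>' zs \<psi>
  proof -
    have eq: "\<sigma> v = \<sigma>' v" if "v \<in> all_vars \<phi>" for v
      using fresh[OF \<open>(zs, \<psi>) \<in> I\<close>] that \<open>\<And>v. v \<notin> set zs \<Longrightarrow> \<sigma>' v = \<sigma> v\<close> by fastforce
    have "\<forall>c \<in># \<alpha>. holds \<sigma>' c"
      using that(5) holds_basic_cong[of \<alpha> \<sigma> \<sigma>'] eq by (auto simp: \<phi>)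
    moreover have "models \<Sigma> \<sigma>' \<chi>" if "\<chi> \<in> set \<phi>s" for \<chi>
    proof (rule models_cong)
      show "models \<Sigma> \<sigma> \<chi>" using that \<open>\<forall>\<chi> \<in> set \<phi>s. models \<Sigma> \<sigma> \<chi>\<close> by blast
      show "\<sigma> v = \<sigma>' v" if "v \<in> free_vars \<chi>" for v
        using that \<open>\<chi> \<in> set \<phi>s\<close> free_vars_subset_all_vars[of \<chi>] by (intro eq) (auto simp: \<phi>)
    qed fact+
    ultimately show ?thesis by blast
  qed
  have "(\<exists>\<psi> \<in> I. \<not> models \<Sigma> \<rho> (instantiate \<phi> \<psi>)) \<longleftrightarrow> \<not> models \<Sigma> \<rho> \<phi>"
  proof
    assume "\<exists>\<psi> \<in> I. \<not> models \<Sigma> \<rho> (instantiate \<phi> \<psi>)"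
    then obtain zs \<psi> where I: "(zs, \<psi>) \<in> I" and "\<not> models \<Sigma> \<rho> (instantiate \<phi> (zs, \<psi>))"
      by auto
    then obtain \<sigma> where \<sigma>: "valuation \<Sigma> \<sigma>" "\<And>v. v \<notin> set xs \<union> set zs \<Longrightarrow> \<sigma> v = \<rho> v"
      "\<forall>c \<in># \<alpha>. holds \<sigma> c" "\<forall>\<chi> \<in> set \<phi>s. models \<Sigma> \<sigma> \<chi>"
      by (auto simp: instantiate_def \<phi>)
    \<comment> \<open>The witness of the instance may differ from \<open>\<rho>\<close> on
      \<open>zs\<close> as well; there it is reset, so that only the variables \<open>xs\<close>
      remain changed.\<close>
    define \<sigma>' where "\<sigma>' = (\<lambda>v. if v \<in> set zs then \<rho> v else \<sigma> v)"
    have val': "valuation \<Sigma> \<sigma>'"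
      using val \<sigma>(1) by (auto simp: valuation_def \<sigma>'_def)
    have "(\<forall>c \<in># \<alpha>. holds \<sigma>' c) \<and> (\<forall>\<chi> \<in> set \<phi>s. models \<Sigma> \<sigma>' \<chi>)"
      using \<sigma> by (intro transfer[OF _ val' I]) (auto simp: \<sigma>'_def)
    moreover have "\<forall>v. v \<notin> set xs \<longrightarrow> \<sigma>' v = \<rho> v"
      using \<sigma>(2) by (auto simp: \<sigma>'_def)
    ultimately show "\<not> models \<Sigma> \<rho> \<phi>"
      using val' by (auto simp: \<phi>)
  next
    assume "\<not> models \<Sigma> \<rho> \<phi>"
    then obtain \<sigma> where \<sigma>: "valuation \<Sigma> \<sigma>" "\<And>v. v \<notin> set xs \<Longrightarrow> \<sigma> v = \<rho> v"
      "\<forall>c \<in># \<alpha>. holds \<sigma> c" "\<forall>\<chi> \<in> set \<phi>s. models \<Sigma> \<sigma> \<chi>"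
      by (auto simp: \<phi>)
    then obtain zs \<psi> \<sigma>' where I: "(zs, \<psi>) \<in> I" and \<sigma>': "valuation \<Sigma> \<sigma>'"
      "\<And>v. v \<notin> set zs \<Longrightarrow> \<sigma>' v = \<sigma> v" "\<forall>c \<in># \<psi>. holds \<sigma>' c"
      using cover[OF \<sigma>(1)] by (auto simp: \<phi>)
    have "(\<forall>c \<in># \<alpha>. holds \<sigma>' c) \<and> (\<forall>\<chi> \<in> set \<phi>s. models \<Sigma> \<sigma>' \<chi>)"
      using \<sigma> \<sigma>' by (intro transfer[OF \<sigma>(1) \<sigma>'(1) I]) auto
    moreover have "\<forall>v. v \<notin> set xs \<and> v \<notin> set zs \<longrightarrow> \<sigma>' v = \<rho> v"
      using \<sigma>(2) \<sigma>'(2) by metis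
    ultimately have "\<not> models \<Sigma> \<rho> (instantiate \<phi> (zs, \<psi>))"
      using \<sigma>'(1,3) by (auto simp: instantiate_def \<phi>)
    with I show "\<exists>\<psi> \<in> I. \<not> models \<Sigma> \<rho> (instantiate \<phi> \<psi>)" by blast
  qed
  then show ?thesis by blast
qed

section \<open>Flattening\<close>

lemma trm_val_cong:
  "(\<And>v. v \<in> trm_vars t \<Longrightarrow> \<rho> v = \<rho>' v) \<Longrightarrow> trm_val \<rho> t = trm_val \<rho>' t"
  by (induction t) auto

lemma tree_of_sort_trm_val:
  assumes "trm_of_sort \<Sigma> s t" "valuation \<Sigma> \<rho>"
  shows "tree_of_sort \<Sigma> s (trm_val \<rho> t)"
  using assms(1)
proof (induction rule: trm_of_sort.induct)
  case (1 v)
  then show ?case using assms(2) by (simp add: valuation_def)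
next
  case (2 g ts)
  have "list_all2 (tree_of_sort \<Sigma>) (gen_args \<Sigma> g) (map (trm_val \<rho>) ts)"
    using 2 by (auto simp: list_all2_conv_all_nth)
  then show ?case by (auto intro: tree_of_sort.intros)
qed

lemma basic_vars_simps [simp]:
  "basic_vars {#} = {}"
  "basic_vars (add_mset c \<Gamma>) = conjunct_vars c \<union> basic_vars \<Gamma>"
  "basic_vars (\<Gamma> + \<Delta>) = basic_vars \<Gamma> \<union> basic_vars \<Delta>"
  by (auto simp: basic_vars_def)

lemma well_sorted_basic_simps [simp]:
  "well_sorted_basic \<Sigma> {#}"
  "well_sorted_basic \<Sigma> (add_mset c \<Gamma>) \<longleftrightarrow> well_sorted_conjunct \<Sigma> c \<and> well_sorted_basic \<Sigma> \<Gamma>"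
  "well_sorted_basic \<Sigma> (\<Gamma> + \<Delta>) \<longleftrightarrow> well_sorted_basic \<Sigma> \<Gamma> \<and> well_sorted_basic \<Sigma> \<Delta>"
  by (auto simp: well_sorted_basic_def)

lemma flat_vars:
  "flat u t zs \<Gamma> \<Longrightarrow> basic_vars \<Gamma> \<subseteq> insert u (trm_vars t \<union> set zs)"
  "flat_args ws ts zs \<Gamma> \<Longrightarrow>
    set ws \<union> basic_vars \<Gamma> \<subseteq> (\<Union>t \<in> set ts. trm_vars t) \<union> set zs"
  by (induction rule: flat_flat_args.inducts) auto

inductive_cases trm_of_sort_TAppE: "trm_of_sort \<Sigma> s (TApp g ts)"

text \<open>Each fresh variable names a subterm and receives the value of that subterm. The root
  variable \<open>u\<close> already has its value, whereas the argument variables \<open>ws\<close>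
  obtain theirs in the construction, which explains the different shapes of the two claims.\<close>

lemma flat_extend:
  "flat u t zs \<Gamma> \<Longrightarrow>
    (\<And>\<rho>. \<lbrakk>valuation \<Sigma> \<rho>; trm_of_sort \<Sigma> (var_sort \<Sigma> u) t; well_sorted_basic \<Sigma> \<Gamma>; distinct zs;
       set zs \<inter> insert u (trm_vars t) = {}; \<rho> u = trm_val \<rho> t\<rbrakk> \<Longrightarrow>
     \<exists>\<rho>'. valuation \<Sigma> \<rho>' \<and> (\<forall>v. v \<notin> set zs \<longrightarrow> \<rho>' v = \<rho> v) \<and> (\<forall>c \<in># \<Gamma>. holds \<rho>' c))"
  "flat_args ws ts zs \<Gamma> \<Longrightarrow>
    (\<And>\<rho>. \<lbrakk>valuation \<Sigma> \<rho>; list_all2 (trm_of_sort \<Sigma>) (map (var_sort \<Sigma>) ws) ts;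
       well_sorted_basic \<Sigma> \<Gamma>; distinct zs; set zs \<inter> (\<Union>t \<in> set ts. trm_vars t) = {}\<rbrakk> \<Longrightarrow>
     \<exists>\<rho>'. valuation \<Sigma> \<rho>' \<and> (\<forall>v. v \<notin> set zs \<longrightarrow> \<rho>' v = \<rho> v) \<and> (\<forall>c \<in># \<Gamma>. holds \<rho>' c) \<and>
       map \<rho>' ws = map (trm_val \<rho>) ts)"
proof (induction rule: flat_flat_args.inducts)
  case (1 u w)
  then show ?case by (intro exI[of _ \<rho>]) auto
next
  case (2 ws ts zs \<Gamma> u g)
  from 2(4) have "list_all2 (trm_of_sort \<Sigma>) (gen_args \<Sigma> g) ts"
    by (auto elim: trm_of_sort_TAppE)
  with 2(5) have "list_all2 (trm_of_sort \<Sigma>) (map (var_sort \<Sigma>) ws) ts" by simp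
  moreover have "well_sorted_basic \<Sigma> \<Gamma>" "set zs \<inter> (\<Union>t \<in> set ts. trm_vars t) = {}"
    using 2 by auto
  ultimately obtain \<rho>' where "valuation \<Sigma> \<rho>'" "\<forall>v. v \<notin> set zs \<longrightarrow> \<rho>' v = \<rho> v"
    "\<forall>c \<in># \<Gamma>. holds \<rho>' c" "map \<rho>' ws = map (trm_val \<rho>) ts"
    using "2.IH"[OF "2.prems"(1)] "2.prems"(4) by blast
  with 2 show ?case by (intro exI[of _ \<rho>']) auto
next
  case 3
  then show ?case by (intro exI[of _ \<rho>]) auto
next
  case (4 ws ts zs \<Gamma> w)
  then have "list_all2 (trm_of_sort \<Sigma>) (map (var_sort \<Sigma>) ws) ts"
    "set zs \<inter> (\<Union>t \<in> set ts. trm_vars t) = {}"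
    by auto
  then obtain \<rho>' where "valuation \<Sigma> \<rho>'" "\<forall>v. v \<notin> set zs \<longrightarrow> \<rho>' v = \<rho> v"
    "\<forall>c \<in># \<Gamma>. holds \<rho>' c" "map \<rho>' ws = map (trm_val \<rho>) ts"
    using "4.IH"[OF "4.prems"(1)] "4.prems"(3,4) by blast
  with 4 show ?case by (intro exI[of _ \<rho>']) auto
next
  case (5 z g rs zs \<Gamma> ws ts zs' \<Gamma>')
  let ?t = "TApp g rs"
  \<comment> \<open>Three successive extensions: first \<open>z\<close> for the subterm itself, then
    \<open>zs\<close> for its interior, then \<open>zs'\<close> for the remaining arguments.
    Distinctness and freshness keep each from disturbing the earlier ones.\<close>
  define \<rho>1 where "\<rho>1 = \<rho>(z := trm_val \<rho> ?t)"
  have sort: "trm_of_sort \<Sigma> (var_sort \<Sigma> z) ?t" using 5 by simp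
  have val1: "valuation \<Sigma> \<rho>1"
    using tree_of_sort_trm_val[OF sort] 5(5) by (auto simp: valuation_def \<rho>1_def)
  have z: "z \<notin> trm_vars ?t" using 5 by auto
  have "trm_val \<rho>1 ?t = trm_val \<rho> ?t"
    using z by (intro trm_val_cong) (auto simp: \<rho>1_def)
  then have "\<rho>1 z = trm_val \<rho>1 ?t" by (simp add: \<rho>1_def)
  moreover have "set zs \<inter> insert z (trm_vars ?t) = {}" "well_sorted_basic \<Sigma> \<Gamma>" "distinct zs"
    using 5 by auto
  ultimately obtain \<rho>2 where \<rho>2: "valuation \<Sigma> \<rho>2" "\<And>v. v \<notin> set zs \<Longrightarrow> \<rho>2 v = \<rho>1 v"
    "\<forall>c \<in># \<Gamma>. holds \<rho>2 c"
    using "5.IH"(1)[OF val1 sort] by blast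
  have "list_all2 (trm_of_sort \<Sigma>) (map (var_sort \<Sigma>) ws) ts" "well_sorted_basic \<Sigma> \<Gamma>'"
    "distinct zs'" "set zs' \<inter> (\<Union>t \<in> set ts. trm_vars t) = {}"
    using 5 by auto
  then obtain \<rho>3 where \<rho>3: "valuation \<Sigma> \<rho>3" "\<And>v. v \<notin> set zs' \<Longrightarrow> \<rho>3 v = \<rho>2 v"
    "\<forall>c \<in># \<Gamma>'. holds \<rho>3 c" "map \<rho>3 ws = map (trm_val \<rho>2) ts"
    using "5.IH"(2)[OF \<rho>2(1)] by blast
  \<comment> \<open>The conjuncts for the first argument do not mention the fresh variables of the
    later ones, so they survive the last extension.\<close>
  have "set zs' \<inter> basic_vars \<Gamma> = {}"
    using flat_vars(1)[OF 5(1)] 5 by fastforce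
  then have "\<forall>c \<in># \<Gamma>. holds \<rho>3 c"
    using \<rho>2(3) \<rho>3(2) holds_basic_cong[of \<Gamma> \<rho>3 \<rho>2] by (metis disjoint_iff)
  moreover have "trm_val \<rho>2 t = trm_val \<rho> t" if "t \<in> set ts" for t
  proof (rule trm_val_cong)
    fix v assume "v \<in> trm_vars t"
    then have "v \<notin> set zs" "v \<noteq> z" using 5 that by auto
    then show "\<rho>2 v = \<rho> v" using \<rho>2(2) by (simp add: \<rho>1_def)
  qed
  moreover have "\<rho>3 z = trm_val \<rho> ?t"
    using 5 \<rho>3(2)[of z] \<rho>2(2)[of z] by (simp add: \<rho>1_def)
  moreover have "\<rho>3 v = \<rho> v" if "v \<notin> set (z # zs @ zs')" for v
    using that \<rho>3(2)[of v] \<rho>2(2)[of v] by (simp add: \<rho>1_def)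
  ultimately show ?case
    using \<rho>3 by (intro exI[of _ \<rho>3]) auto
qed

section \<open>The variables for unique infinite trees\<close>

text \<open>Shows that no sort is empty: \<open>p\<close> selects a generator for each sort and
  \<open>a\<close> lists its argument sorts. Corecursion is used because a sort may have no finite
  tree at all.\<close>

primcorec default_tree :: "('s \<Rightarrow> 'g) \<Rightarrow> ('g \<Rightarrow> 's list) \<Rightarrow> 's \<Rightarrow> 'g tree" where
  "default_tree p a s = Node (p s) (map (default_tree p a) (a (p s)))"

lemma tree_of_sort_default_tree:
  assumes "\<And>s. gen_sort \<Sigma> (p s) = s"
  shows "tree_of_sort \<Sigma> s (default_tree p (gen_args \<Sigma>) s)"
proof (coinduction arbitrary: s rule: tree_of_sort.coinduct)
  case tree_of_sort
  have "default_tree p (gen_args \<Sigma>) s =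
      Node (p s) (map (default_tree p (gen_args \<Sigma>)) (gen_args \<Sigma> (p s)))"
    by (rule default_tree.code)
  then show ?case
    using assms by (intro exI[of _ "p s"]) (auto simp: list_all2_conv_all_nth)
qed

section \<open>Consequences of admissibility and nonemptiness of the sorts\<close>

lemma admissible_gens:
  assumes "admissible \<Sigma>"
  obtains g h where "g \<noteq> h" "g \<in> gens \<Sigma> s" "h \<in> gens \<Sigma> s"
  using conjunct1[OF assms[unfolded admissible_def]] by blast

lemma admissible_one_inf: "admissible \<Sigma> \<Longrightarrow> set (one_inf \<Sigma>) = S_1I \<Sigma>"
  unfolding admissible_def by (elim conjE)

lemma admissible_uvar:
  assumes "admissible \<Sigma>" "s \<in> S_1I \<Sigma>"
  shows "var_sort \<Sigma> (uvar \<Sigma> s) = s" and "finite (ueqs \<Sigma> s)"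
    and "c \<in> ueqs \<Sigma> s \<Longrightarrow> well_sorted_conjunct \<Sigma> c"
    and "c \<in> ueqs \<Sigma> s \<Longrightarrow>
      \<exists>r \<in> S_1I \<Sigma>. \<exists>g. \<exists>r' \<in> S_1I \<Sigma>. c = Eq (uvar \<Sigma> r) (App g [uvar \<Sigma> r'])"
proof -
  note * = assms(1)[unfolded admissible_def]
  from conjunct1[OF conjunct2[OF conjunct2[OF conjunct2[OF *]]]]
    conjunct1[OF conjunct2[OF conjunct2[OF conjunct2[OF conjunct2[OF *]]]]]
  show "var_sort \<Sigma> (uvar \<Sigma> s) = s" and "finite (ueqs \<Sigma> s)"
    and "c \<in> ueqs \<Sigma> s \<Longrightarrow> well_sorted_conjunct \<Sigma> c"
    and "c \<in> ueqs \<Sigma> s \<Longrightarrow>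
      \<exists>r \<in> S_1I \<Sigma>. \<exists>g. \<exists>r' \<in> S_1I \<Sigma>. c = Eq (uvar \<Sigma> r) (App g [uvar \<Sigma> r'])"
    using assms(2) by blast+
qed

lemma admissible_ueqs:
  assumes "admissible \<Sigma>" "valuation \<Sigma> \<rho>"
  shows "(\<forall>s \<in> S_1I \<Sigma>. \<forall>c \<in> ueqs \<Sigma> s. holds \<rho> c) \<longleftrightarrow>
    (\<forall>s \<in> S_1I \<Sigma>. \<rho> (uvar \<Sigma> s) \<in> inf_trees \<Sigma> s)"
proof -
  note * = assms(1)[unfolded admissible_def]
  show ?thesis
    using conjunct1[OF conjunct2[OF conjunct2[OF conjunct2[OF conjunct2[OF conjunct2[OF *]]]]]]
      assms(2) by blast
qed

lemma admissible_fin_terms: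
  assumes "admissible \<Sigma>" "s \<in> S_FF \<Sigma>"
  shows "finite (fin_terms \<Sigma> s)"
    and "t \<in> fin_terms \<Sigma> s \<Longrightarrow> trm_of_sort \<Sigma> s t"
    and "t \<in> fin_terms \<Sigma> s \<Longrightarrow> trm_vars t = {}"
    and "valuation \<Sigma> \<rho> \<Longrightarrow> trm_val \<rho> ` fin_terms \<Sigma> s = fin_trees \<Sigma> s"
proof -
  note * = assms(1)[unfolded admissible_def]
  from conjunct1[OF conjunct2[OF conjunct2[OF conjunct2[OF conjunct2[OF conjunct2[OF conjunct2[OF *]]]]]]]
  show "finite (fin_terms \<Sigma> s)"
    and "t \<in> fin_terms \<Sigma> s \<Longrightarrow> trm_of_sort \<Sigma> s t"
    and "t \<in> fin_terms \<Sigma> s \<Longrightarrow> trm_vars t = {}"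
    and "valuation \<Sigma> \<rho> \<Longrightarrow> trm_val \<rho> ` fin_terms \<Sigma> s = fin_trees \<Sigma> s"
    using assms(2) by blast+
qed

lemma admissible_inf_terms:
  assumes "admissible \<Sigma>" "s \<in> S_FI \<Sigma>"
  shows "finite (inf_terms \<Sigma> s)"
    and "t \<in> inf_terms \<Sigma> s \<Longrightarrow> trm_of_sort \<Sigma> s t"
    and "t \<in> inf_terms \<Sigma> s \<Longrightarrow> trm_vars t \<subseteq> uvar \<Sigma> ` S_1I \<Sigma>"
    and "\<lbrakk>valuation \<Sigma> \<rho>; \<forall>r \<in> S_1I \<Sigma>. \<rho> (uvar \<Sigma> r) \<in> inf_trees \<Sigma> r\<rbrakk> \<Longrightarrow>
      trm_val \<rho> ` inf_terms \<Sigma> s = inf_trees \<Sigma> s"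
proof -
  note * = assms(1)[unfolded admissible_def]
  from conjunct2[OF conjunct2[OF conjunct2[OF conjunct2[OF conjunct2[OF conjunct2[OF conjunct2[OF *]]]]]]]
  show "finite (inf_terms \<Sigma> s)"
    and "t \<in> inf_terms \<Sigma> s \<Longrightarrow> trm_of_sort \<Sigma> s t"
    and "t \<in> inf_terms \<Sigma> s \<Longrightarrow> trm_vars t \<subseteq> uvar \<Sigma> ` S_1I \<Sigma>"
    and "\<lbrakk>valuation \<Sigma> \<rho>; \<forall>r \<in> S_1I \<Sigma>. \<rho> (uvar \<Sigma> r) \<in> inf_trees \<Sigma> r\<rbrakk> \<Longrightarrow>
      trm_val \<rho> ` inf_terms \<Sigma> s = inf_trees \<Sigma> s"
    using assms(2) by blast+
qed

lemma admissible_tree_exists: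
  assumes "admissible \<Sigma>"
  shows "\<exists>t. tree_of_sort \<Sigma> s t"
proof -
  have "\<forall>s. \<exists>g. gen_sort \<Sigma> g = s"
    using admissible_gens[OF assms] unfolding gens_def by blast
  then obtain p where "\<And>s. gen_sort \<Sigma> (p s) = s" by metis
  from tree_of_sort_default_tree[of \<Sigma> p, OF this] show ?thesis by blast
qed

lemma tree_of_sort_Node_exists:
  assumes "admissible \<Sigma>" "g \<in> gens \<Sigma> s"
  shows "\<exists>ts. tree_of_sort \<Sigma> s (Node g ts)"
proof -
  obtain f where "\<And>s. tree_of_sort \<Sigma> s (f s)"
    using admissible_tree_exists[OF assms(1)] by metis
  then have "list_all2 (tree_of_sort \<Sigma>) (gen_args \<Sigma> g) (map f (gen_args \<Sigma> g))"
    by (simp add: list_all2_conv_all_nth)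
  then have "tree_of_sort \<Sigma> (gen_sort \<Sigma> g) (Node g (map f (gen_args \<Sigma> g)))"
    by (rule tree_of_sort.intros)
  then show ?thesis using assms(2) by (auto simp: gens_def)
qed

text \<open>Two generators of the sort head two different trees, and at most one of these is
  infinite.\<close>

lemma S_1I_fin_tree_exists:
  assumes "admissible \<Sigma>" "s \<in> S_1I \<Sigma>"
  shows "\<exists>t. tree_of_sort \<Sigma> s t \<and> fin_tree t"
proof -
  obtain g h where "g \<noteq> h" "g \<in> gens \<Sigma> s" "h \<in> gens \<Sigma> s"
    using admissible_gens[OF assms(1)] by blast
  then obtain ts ts' where "tree_of_sort \<Sigma> s (Node g ts)" "tree_of_sort \<Sigma> s (Node h ts')"
    using tree_of_sort_Node_exists[OF assms(1)] by blast
  moreover have "\<forall>t t'. t \<in> inf_trees \<Sigma> s \<longrightarrow> t' \<in> inf_trees \<Sigma> s \<longrightarrow> t = t'"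
    using assms(2) by (auto simp: S_1I_def)
  ultimately show ?thesis
    using \<open>g \<noteq> h\<close> unfolding inf_trees_def by blast
qed

lemma extend_to_uvars:
  assumes adm: "admissible \<Sigma>" and val: "valuation \<Sigma> \<rho>"
  obtains \<rho>' where "valuation \<Sigma> \<rho>'" "\<And>v. v \<notin> uvar \<Sigma> ` S_1I \<Sigma> \<Longrightarrow> \<rho>' v = \<rho> v"
    "\<And>s. s \<in> S_1I \<Sigma> \<Longrightarrow> \<rho>' (uvar \<Sigma> s) \<in> inf_trees \<Sigma> s"
proof -
  have "\<forall>s \<in> S_1I \<Sigma>. \<exists>t. t \<in> inf_trees \<Sigma> s" by (auto simp: S_1I_def)
  then obtain f where f: "\<And>s. s \<in> S_1I \<Sigma> \<Longrightarrow> f s \<in> inf_trees \<Sigma> s" by metis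
  \<comment> \<open>Since \<open>u_s\<close> has sort \<open>s\<close>, the sort of a variable
    determines which \<open>u_s\<close> it is, and \<open>f (var_sort \<Sigma> v)\<close> is the
    intended tree.\<close>
  define \<rho>' where "\<rho>' = (\<lambda>v. if v \<in> uvar \<Sigma> ` S_1I \<Sigma> then f (var_sort \<Sigma> v) else \<rho> v)"
  have "valuation \<Sigma> \<rho>'"
    using val f admissible_uvar(1)[OF adm] by (auto simp: valuation_def \<rho>'_def inf_trees_def)
  moreover have "\<rho>' v = \<rho> v" if "v \<notin> uvar \<Sigma> ` S_1I \<Sigma>" for v
    using that by (auto simp: \<rho>'_def)
  moreover have "\<rho>' (uvar \<Sigma> s) \<in> inf_trees \<Sigma> s" if "s \<in> S_1I \<Sigma>" for s
    using that f admissible_uvar(1)[OF adm] by (auto simp: \<rho>'_def)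
  ultimately show thesis by (rule that)
qed

text \<open>If \<open>u\<^sub>r\<close> had no equation, then a tree \<open>t\<close> of sort \<open>r\<close> could be chosen freely for it and
  propagated backwards through the equations.\<close>

inductive unfolds ::
    "('s, 'g, 'v) signature \<Rightarrow> 's \<Rightarrow> 'g tree \<Rightarrow> 's \<Rightarrow> 'g tree \<Rightarrow> bool" for \<Sigma> r t where
  base: "unfolds \<Sigma> r t r t"
| step: "\<lbrakk>s \<in> S_1I \<Sigma>; q \<in> S_1I \<Sigma>; q' \<in> S_1I \<Sigma>; Eq (uvar \<Sigma> q) (App g [uvar \<Sigma> q']) \<in> ueqs \<Sigma> s;
     unfolds \<Sigma> r t q' t'\<rbrakk> \<Longrightarrow> unfolds \<Sigma> r t q (Node g [t'])"

text \<open>Needed for instances \<open>u = u_r\<close> whose term is a bare variable: the equation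
  supplies a generator in the class of \<open>u\<close>. Without it, a finite tree could be assigned
  to \<open>u_r\<close> while all the equations hold, although these force an infinite
  value.\<close>

lemma uvar_has_equation:
  assumes adm: "admissible \<Sigma>" and r: "r \<in> S_1I \<Sigma>"
  shows "\<exists>s \<in> S_1I \<Sigma>. \<exists>g zs. Eq (uvar \<Sigma> r) (App g zs) \<in> ueqs \<Sigma> s"
proof (rule ccontr)
  assume none: "\<not> ?thesis"
  obtain t where t: "tree_of_sort \<Sigma> r t" "fin_tree t"
    using S_1I_fin_tree_exists[OF adm r] by blast
  obtain f where "\<And>s. tree_of_sort \<Sigma> s (f s)"
    using admissible_tree_exists[OF adm] by metis
  then have "valuation \<Sigma> (\<lambda>v. f (var_sort \<Sigma> v))" by (simp add: valuation_def)
  from extend_to_uvars[OF adm this] obtain \<rho> where \<rho>: "valuation \<Sigma> \<rho>"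
    "\<And>s. s \<in> S_1I \<Sigma> \<Longrightarrow> \<rho> (uvar \<Sigma> s) \<in> inf_trees \<Sigma> s" by metis
  then have eqs: "holds \<rho> c" if "s \<in> S_1I \<Sigma>" "c \<in> ueqs \<Sigma> s" for s c
    using admissible_ueqs[OF adm \<rho>(1)] that by blast
  have sorts: "gen_sort \<Sigma> g = q \<and> gen_args \<Sigma> g = [q']"
    if "s \<in> S_1I \<Sigma>" "q \<in> S_1I \<Sigma>" "q' \<in> S_1I \<Sigma>"
      "Eq (uvar \<Sigma> q) (App g [uvar \<Sigma> q']) \<in> ueqs \<Sigma> s" for s q q' g
    using admissible_uvar(3)[OF adm that(1,4)] admissible_uvar(1)[OF adm] that(2,3) by auto
  \<comment> \<open>Both equations hold under \<open>\<rho>\<close>, so they share their generator,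
    and its argument sort determines the variable on the right.\<close>
  have det: "g = h \<and> q1 = q2"
    if "s \<in> S_1I \<Sigma>" "s' \<in> S_1I \<Sigma>" "q \<in> S_1I \<Sigma>" "q1 \<in> S_1I \<Sigma>" "q2 \<in> S_1I \<Sigma>"
      "Eq (uvar \<Sigma> q) (App g [uvar \<Sigma> q1]) \<in> ueqs \<Sigma> s"
      "Eq (uvar \<Sigma> q) (App h [uvar \<Sigma> q2]) \<in> ueqs \<Sigma> s'" for s s' q q1 q2 g h
  proof -
    have "g = h" using eqs[OF that(1,6)] eqs[OF that(2,7)] by simp
    moreover have "gen_args \<Sigma> g = [q1]" "gen_args \<Sigma> h = [q2]"
      using sorts[OF that(1,3,4,6)] sorts[OF that(2,3,5,7)] by blast+
    ultimately show ?thesis by simp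
  qed
  have unf: "tree_of_sort \<Sigma> q t' \<and> fin_tree t'" if "unfolds \<Sigma> r t q t'" for q t'
    using that
  proof induction
    case (step s q q' g t')
    then have "list_all2 (tree_of_sort \<Sigma>) (gen_args \<Sigma> g) [t']" "gen_sort \<Sigma> g = q"
      using sorts by auto
    then show ?case
      using tree_of_sort.intros[of \<Sigma> g "[t']"] step by (auto intro: fin_tree.intros)
  qed (use t in auto)
  \<comment> \<open>An unfolding that has arrived at \<open>r\<close> cannot continue, because
    \<open>u_r\<close> is assumed to have no equation; every other step is forced by
    \<open>det\<close>.\<close>
  have unf_det: "t1 = t2" if "unfolds \<Sigma> r t q t1" "unfolds \<Sigma> r t q t2" for q t1 t2
    using that
  proof (induction arbitrary: t2)
    case base
    then show ?case using none by (cases rule: unfolds.cases) auto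
  next
    case (step s q q' g t')
    from step.prems show ?case
    proof (cases rule: unfolds.cases)
      case base
      then show ?thesis using none step by blast
    next
      case (step s2 q2' g2 t2')
      then show ?thesis
        using det[of s s2 q q' q2' g g2] step.IH step.hyps
          \<open>s \<in> S_1I \<Sigma>\<close> \<open>q \<in> S_1I \<Sigma>\<close> \<open>q' \<in> S_1I \<Sigma>\<close> by blast
    qed
  qed
  \<comment> \<open>Exactly the variables from which the equations lead to \<open>u_r\<close> are
    changed; the others keep their values under \<open>\<rho>\<close>.\<close>
  define \<sigma> where "\<sigma> = (\<lambda>v. if v \<in> uvar \<Sigma> ` S_1I \<Sigma> \<and> (\<exists>t'. unfolds \<Sigma> r t (var_sort \<Sigma> v) t')
    then (THE t'. unfolds \<Sigma> r t (var_sort \<Sigma> v) t') else \<rho> v)"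
  have \<sigma>1: "\<sigma> (uvar \<Sigma> q) = t'" if "q \<in> S_1I \<Sigma>" "unfolds \<Sigma> r t q t'" for q t'
    using that unf_det admissible_uvar(1)[OF adm] by (auto simp: \<sigma>_def intro!: the_equality)
  have \<sigma>2: "\<sigma> (uvar \<Sigma> q) = \<rho> (uvar \<Sigma> q)" if "q \<in> S_1I \<Sigma>" "\<nexists>t'. unfolds \<Sigma> r t q t'" for q
    using that admissible_uvar(1)[OF adm] by (auto simp: \<sigma>_def)
  have "tree_of_sort \<Sigma> (var_sort \<Sigma> v) (\<sigma> v)" for v
  proof (cases "v \<in> uvar \<Sigma> ` S_1I \<Sigma> \<and> (\<exists>t'. unfolds \<Sigma> r t (var_sort \<Sigma> v) t')")
    case True
    then show ?thesis using \<sigma>1 unf admissible_uvar(1)[OF adm] by fastforce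
  next
    case False
    then show ?thesis using \<rho>(1) by (auto simp: \<sigma>_def valuation_def)
  qed
  then have val: "valuation \<Sigma> \<sigma>" by (simp add: valuation_def)
  have "holds \<sigma> c" if sc: "s \<in> S_1I \<Sigma>" "c \<in> ueqs \<Sigma> s" for s c
  proof -
    obtain q g q' where q: "q \<in> S_1I \<Sigma>" "q' \<in> S_1I \<Sigma>" "c = Eq (uvar \<Sigma> q) (App g [uvar \<Sigma> q'])"
      using admissible_uvar(4)[OF adm sc] by blast
    show ?thesis
    proof (cases "\<exists>t'. unfolds \<Sigma> r t q' t'")
      case True
      then obtain t' where t': "unfolds \<Sigma> r t q' t'" by blast
      then have "unfolds \<Sigma> r t q (Node g [t'])"
        using unfolds.step[OF sc(1) q(1,2)] sc(2) q(3) by blast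
      then show ?thesis using t' q \<sigma>1 by simp
    next
      case False
      \<comment> \<open>By \<open>det\<close> an unfolding of \<open>q\<close> would pass through
        \<open>q'\<close>, and \<open>q\<close> is not \<open>r\<close> because \<open>u_q\<close>
        has an equation. Hence both sides of the equation keep their values under
        \<open>\<rho>\<close>.\<close>
      have "\<nexists>t'. unfolds \<Sigma> r t q t'"
      proof
        assume "\<exists>t'. unfolds \<Sigma> r t q t'"
        then obtain t' where "unfolds \<Sigma> r t q t'" by blast
        then show False
        proof (cases rule: unfolds.cases)
          case base
          then show ?thesis using none sc q by blast
        next
          case (step s2 q2' g2 t2')
          then show ?thesis
            using det[of s s2 q q' q2' g g2] sc q False by blast
        qed
      qed
      then show ?thesis using False q \<sigma>2 eqs[OF sc] by simp
    qed
  qed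
  then have "\<sigma> (uvar \<Sigma> r) \<in> inf_trees \<Sigma> r"
    using admissible_ueqs[OF adm val] r by blast
  then show False
    using \<sigma>1[OF r unfolds.base] t by (simp add: inf_trees_def)
qed

section \<open>Invariants of solving\<close>

definition veq :: "('g, 'v) basic \<Rightarrow> ('v \<times> 'v) set" where
  "veq \<Gamma> = {(x, y). Eq x (Var y) \<in># \<Gamma>}"

abbreviation vclass :: "('g, 'v) basic \<Rightarrow> ('v \<times> 'v) set" where
  "vclass \<Gamma> \<equiv> (veq \<Gamma> \<union> (veq \<Gamma>)\<inverse>)\<^sup>*"

definition nonminimal :: "('g, 'v::linorder) basic \<Rightarrow> 'v \<Rightarrow> bool" where
  "nonminimal \<Gamma> u \<longleftrightarrow> (\<exists>w < u. (u, w) \<in> vclass \<Gamma>)"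

text \<open>In a solved formula the first disjunct yields an equation \<open>u = y\<close>; if it
  fails, the second one yields \<open>u = g(zs)\<close>.\<close>

definition anchored :: "('g, 'v::linorder) basic \<Rightarrow> 'v \<Rightarrow> bool" where
  "anchored \<Gamma> u \<longleftrightarrow>
     nonminimal \<Gamma> u \<or> (\<exists>w g zs. (u, w) \<in> vclass \<Gamma> \<and> Eq w (App g zs) \<in># \<Gamma>)"

lemma vclassI:
  assumes "Eq x (Var y) \<in># \<Gamma>"
  shows "(x, y) \<in> vclass \<Gamma>" and "(y, x) \<in> vclass \<Gamma>"
  using assms by (auto simp: veq_def)

text \<open>Orientation reverses the equation, and a trivial equation connects nothing new.
  Replacement turns \<open>x = z\<close> into \<open>y = z\<close> but keeps \<open>x = y\<close>,
  so \<open>x\<close> and \<open>z\<close> stay connected.\<close>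

lemma solve_step_veq:
  assumes "solve_step \<Sigma> A \<Gamma> \<Gamma>'" "Eq x (Var y) \<in># \<Gamma>"
  shows "(x, y) \<in> vclass \<Gamma>'"
  using assms
proof (cases rule: solve_step.cases)
  case (replace a b t \<Delta>)
  have "(a, b) \<in> vclass \<Gamma>'" using replace by (intro vclassI) auto
  moreover have "(b, y) \<in> vclass \<Gamma>'" if "t = Var y"
    using replace that by (intro vclassI) auto
  ultimately show ?thesis
    using replace assms(2) by (auto intro: vclassI rtrancl_trans)
qed (use assms(2) in \<open>auto intro: vclassI\<close>)

lemma solve_step_vclass:
  assumes "solve_step \<Sigma> A \<Gamma> \<Gamma>'"
  shows "vclass \<Gamma> \<subseteq> vclass \<Gamma>'"
proof -
  have "veq \<Gamma> \<subseteq> vclass \<Gamma>'"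
    using solve_step_veq[OF assms] by (auto simp: veq_def)
  moreover have "sym (vclass \<Gamma>')"
    by (intro sym_rtrancl sym_Un_converse)
  ultimately have "veq \<Gamma> \<union> (veq \<Gamma>)\<inverse> \<subseteq> vclass \<Gamma>'"
    by (auto dest: symD)
  then show ?thesis by (rule rtrancl_subset_rtrancl)
qed

text \<open>Replacement moves an equation with a generator only within a class, and decomposition
  leaves another such equation for the same variable. The equation may change, but the class retains
  one.\<close>

lemma solve_step_App:
  assumes "solve_step \<Sigma> A \<Gamma> \<Gamma>'" "Eq w (App g zs) \<in># \<Gamma>"
  shows "\<exists>w' h ys. (w, w') \<in> vclass \<Gamma>' \<and> Eq w' (App h ys) \<in># \<Gamma>'"
  using assms
proof (cases rule: solve_step.cases)
  case (replace a b t \<Delta>)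
  have "(a, b) \<in> vclass \<Gamma>'" using replace by (intro vclassI) auto
  then show ?thesis using replace assms(2) by auto
qed (use assms(2) in auto)

lemma solve_step_nonminimal:
  "solve_step \<Sigma> A \<Gamma> \<Gamma>' \<Longrightarrow> nonminimal \<Gamma> u \<Longrightarrow> nonminimal \<Gamma>' u"
  using solve_step_vclass[of \<Sigma> A \<Gamma> \<Gamma>'] unfolding nonminimal_def by blast

lemma solve_steps_nonminimal:
  "(solve_step \<Sigma> A)\<^sup>*\<^sup>* \<Gamma> \<Gamma>' \<Longrightarrow> nonminimal \<Gamma> u \<Longrightarrow> nonminimal \<Gamma>' u"
  by (induction rule: rtranclp_induct) (auto intro: solve_step_nonminimal)

lemma solve_step_anchored:
  assumes "solve_step \<Sigma> A \<Gamma> \<Gamma>'" "anchored \<Gamma> u"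
  shows "anchored \<Gamma>' u"
proof (cases "nonminimal \<Gamma> u")
  case True
  then show ?thesis using solve_step_nonminimal[OF assms(1)] by (auto simp: anchored_def)
next
  case False
  then obtain w g zs where w: "(u, w) \<in> vclass \<Gamma>" "Eq w (App g zs) \<in># \<Gamma>"
    using assms(2) by (auto simp: anchored_def)
  obtain w' h ys where "(w, w') \<in> vclass \<Gamma>'" "Eq w' (App h ys) \<in># \<Gamma>'"
    using solve_step_App[OF assms(1) w(2)] by blast
  moreover have "(u, w) \<in> vclass \<Gamma>'" using w(1) solve_step_vclass[OF assms(1)] by blast
  ultimately have "(u, w') \<in> vclass \<Gamma>'" by (metis rtrancl_trans)
  with \<open>Eq w' (App h ys) \<in># \<Gamma>'\<close> show ?thesis unfolding anchored_def by blast
qed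

lemma solve_steps_anchored:
  "(solve_step \<Sigma> A)\<^sup>*\<^sup>* \<Gamma> \<Gamma>' \<Longrightarrow> anchored \<Gamma> u \<Longrightarrow> anchored \<Gamma>' u"
  by (induction rule: rtranclp_induct) (auto intro: solve_step_anchored)

text \<open>Of two equations for \<open>u\<close>, decomposition keeps the one in \<open>A\<close>.\<close>

lemma solve_step_keeps_App:
  assumes "solve_step \<Sigma> A \<Gamma> \<Gamma>'" "Eq u (App g zs) \<in># \<Gamma>" "Eq u (App g zs) \<in> A"
    and unique: "\<And>h ws. Eq u (App h ws) \<in> A \<Longrightarrow> h = g \<and> ws = zs"
  shows "Eq u (App g zs) \<in># \<Gamma>' \<or> nonminimal \<Gamma>' u"
  using assms(1)
proof (cases rule: solve_step.cases)
  case (replace a b t \<Delta>)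
  \<comment> \<open>Moving the equation away from \<open>u\<close> takes an equation
    \<open>u = b\<close> with \<open>b < u\<close>, which makes \<open>u\<close> nonminimal.\<close>
  have "(a, b) \<in> vclass \<Gamma>'" using replace by (intro vclassI) auto
  then show ?thesis using replace assms(2) by (auto simp: nonminimal_def)
next
  case (decompose x h ws ys \<Delta>)
  show ?thesis
  proof (cases "Eq u (App g zs) = Eq x (App h ws)")
    case True
    \<comment> \<open>If the discarded equation lies in \<open>A\<close>, so does the kept one by
      the side condition; as \<open>A\<close> has only one such equation for \<open>u\<close>, the
      two coincide.\<close>
    then have "Eq x (App h ys) \<in> A" using assms(3) decompose(3) by simp
    then have "ys = ws" using unique True by blast
    then show ?thesis using True decompose by simp
  next
    case False
    then show ?thesis using assms(2) decompose by auto
  qed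
qed (use assms(2) in auto)

lemma solve_steps_keep_App:
  assumes "(solve_step \<Sigma> A)\<^sup>*\<^sup>* \<Gamma> \<Gamma>'" "Eq u (App g zs) \<in># \<Gamma>" "Eq u (App g zs) \<in> A"
    and "\<And>h ws. Eq u (App h ws) \<in> A \<Longrightarrow> h = g \<and> ws = zs"
  shows "Eq u (App g zs) \<in># \<Gamma>' \<or> nonminimal \<Gamma>' u"
  using assms(1)
proof (induction rule: rtranclp_induct)
  case (step \<Delta> \<Delta>')
  then show ?case
    using solve_step_keeps_App[OF step(2) _ assms(3,4)] solve_step_nonminimal[OF step(2)] by blast
qed (use assms(2) in simp)

text \<open>Puts distinctness into the shape of the left-hand sides of the solving rules. Because
  \<open>c\<close> and \<open>d\<close> are split off a multiset, repeated conjuncts are excluded as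
  well.\<close>

lemma subjects_distinct_iff:
  "(\<forall>x. size {# c \<in># \<Gamma>. subject c = x #} \<le> 1) \<longleftrightarrow>
     (\<forall>c d \<Delta>. \<Gamma> = {# c, d #} + \<Delta> \<longrightarrow> subject c \<noteq> subject d)" (is "?L \<longleftrightarrow> ?R")
proof
  assume L: ?L
  show ?R
  proof (intro allI impI notI)
    fix c d \<Delta> assume "\<Gamma> = {# c, d #} + \<Delta>" "subject c = subject d"
    then show False using L[rule_format, of "subject c"] by simp
  qed
next
  assume R: ?R
  show ?L
  proof (rule allI, rule ccontr)
    fix x
    let ?M = "{# c \<in># \<Gamma>. subject c = x #}"
    assume "\<not> size ?M \<le> 1"
    then have "\<exists>n. size ?M = Suc (Suc n)" by presburger
    then obtain n where n: "size ?M = Suc (Suc n)" ..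
    then obtain c M where M: "?M = add_mset c M"
      using size_eq_Suc_imp_eq_union by blast
    with n have "size M = Suc n" by simp
    then obtain d N where "M = add_mset d N"
      using size_eq_Suc_imp_eq_union by blast
    with M have N: "?M = {# c, d #} + N" by simp
    then have "c \<in># ?M" "d \<in># ?M" by simp_all
    then have "subject c = subject d" by simp
    moreover obtain K where "\<Gamma> = ?M + K"
      using multiset_partition[of \<Gamma> "\<lambda>c. subject c = x"] by blast
    with N have "\<Gamma> = {# c, d #} + (N + K)" by (simp add: add.assoc)
    ultimately show False using R by blast
  qed
qed

section \<open>Uniqueness and orientation of equations in solved formulae\<close>

lemma solved_subjects:
  assumes "solved \<Sigma> ({# c, d #} + \<Delta>)"
  shows "subject c \<noteq> subject d"
  using assms unfolding solved_def subjects_distinct_iff by blast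

lemma solved_unique:
  assumes "solved \<Sigma> \<Gamma>" "c \<in># \<Gamma>" "d \<in># \<Gamma>" "subject c = subject d"
  shows "c = d"
proof (rule ccontr)
  assume "c \<noteq> d"
  obtain \<Delta>' where \<Delta>': "\<Gamma> = add_mset c \<Delta>'"
    using assms(2) by (auto dest: multi_member_split)
  then have "d \<in># \<Delta>'" using assms(3) \<open>c \<noteq> d\<close> by simp
  then obtain \<Delta> where "\<Delta>' = add_mset d \<Delta>" by (auto dest: multi_member_split)
  with \<Delta>' have "\<Gamma> = {# c, d #} + \<Delta>" by simp
  then show False using assms(1,4) solved_subjects by blast
qed

lemma solved_Eq_unique: "\<lbrakk>solved \<Sigma> \<Gamma>; Eq x s \<in># \<Gamma>; Eq x t \<in># \<Gamma>\<rbrakk> \<Longrightarrow> s = t"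
  using solved_unique[of \<Sigma> \<Gamma> "Eq x s" "Eq x t"] by simp

lemma solved_Eq_Fin: "\<lbrakk>solved \<Sigma> \<Gamma>; Eq x s \<in># \<Gamma>; Fin x \<in># \<Gamma>\<rbrakk> \<Longrightarrow> False"
  using solved_unique[of \<Sigma> \<Gamma> "Eq x s" "Fin x"] by simp

lemma solved_veq_decreasing:
  assumes "solved \<Sigma> \<Gamma>" "(x, y) \<in> (veq \<Gamma>)\<^sup>*"
  shows "y \<le> x"
  using assms(2)
proof induction
  case (step y z)
  then have "z < y" using assms(1) by (auto simp: veq_def solved_def)
  with step show ?case by simp
qed simp

text \<open>A variable has at most one equation in a solved formula, so \<open>veq\<close> is a
  partial function, and the chains starting from connected variables meet.\<close>

lemma solved_common_root:
  assumes "solved \<Sigma> \<Gamma>" "(u, w) \<in> vclass \<Gamma>"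
  shows "\<exists>r. (u, r) \<in> (veq \<Gamma>)\<^sup>* \<and> (w, r) \<in> (veq \<Gamma>)\<^sup>*"
  using assms(2)
proof induction
  case base
  then show ?case by blast
next
  case (step w w')
  then obtain r where r: "(u, r) \<in> (veq \<Gamma>)\<^sup>*" "(w, r) \<in> (veq \<Gamma>)\<^sup>*" by blast
  from step(2) consider "(w', w) \<in> veq \<Gamma>" | "(w, w') \<in> veq \<Gamma>" by blast
  then show ?case
  proof cases
    assume "(w', w) \<in> (veq \<Gamma>)" then show ?thesis using r by (meson converse_rtrancl_into_rtrancl)
  next
    assume w': "(w, w') \<in> veq \<Gamma>"
    from r(2) show ?thesis
    proof (cases rule: converse_rtranclE)
      case base
      then show ?thesis using r(1) w' by (meson rtrancl.simps)
    next
      case (step y)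
      then have "y = w'"
        using w' solved_Eq_unique[OF assms(1)] by (fastforce simp: veq_def)
      then show ?thesis using r(1) step by blast
    qed
  qed
qed

text \<open>Chains of variable equations decrease, so a common end of the chains from
  \<open>u\<close> and a smaller \<open>w\<close> lies below \<open>u\<close>. The chain from
  \<open>u\<close> therefore has a first step.\<close>

lemma solved_nonminimal:
  assumes "solved \<Sigma> \<Gamma>" "nonminimal \<Gamma> u"
  shows "\<exists>y. Eq u (Var y) \<in># \<Gamma>"
proof -
  obtain w where w: "w < u" "(u, w) \<in> vclass \<Gamma>"
    using assms(2) by (auto simp: nonminimal_def)
  obtain r where r: "(u, r) \<in> (veq \<Gamma>)\<^sup>*" "(w, r) \<in> (veq \<Gamma>)\<^sup>*"
    using solved_common_root[OF assms(1) w(2)] by blast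
  then have "r \<noteq> u"
    using solved_veq_decreasing[OF assms(1) r(2)] w(1) by auto
  with r(1) show ?thesis
    by (cases rule: converse_rtranclE) (auto simp: veq_def)
qed

text \<open>The variable \<open>w\<close> with a generator has no variable equation, so the chain
  from \<open>w\<close> stops immediately and the chain from \<open>u\<close> ends at
  \<open>w\<close>.\<close>

lemma solved_anchored:
  assumes "solved \<Sigma> \<Gamma>" "anchored \<Gamma> u"
  shows "\<exists>t. Eq u t \<in># \<Gamma>"
proof (cases "nonminimal \<Gamma> u")
  case True
  then show ?thesis using solved_nonminimal[OF assms(1)] by blast
next
  case False
  then obtain w g zs where w: "(u, w) \<in> vclass \<Gamma>" "Eq w (App g zs) \<in># \<Gamma>"
    using assms(2) by (auto simp: anchored_def)
  obtain r where r: "(u, r) \<in> (veq \<Gamma>)\<^sup>*" "(w, r) \<in> (veq \<Gamma>)\<^sup>*"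
    using solved_common_root[OF assms(1) w(1)] by blast
  from r(2) have "w = r"
    using solved_Eq_unique[OF assms(1) w(2)]
    by (cases rule: converse_rtranclE) (auto simp: veq_def)
  from r(1) show ?thesis
    using w(2) \<open>w = r\<close> by (cases rule: converse_rtranclE) (auto simp: veq_def)
qed

text \<open>Solvedness of \<open>\<Gamma>\<close> provides the orientation \<open>y < u\<close>,
  which remains available in any formula \<open>\<Delta>\<close> that contains the equation, solved
  or not.\<close>

lemma anchored_Eq:
  assumes "solved \<Sigma> \<Gamma>" "Eq u t \<in># \<Gamma>" and t: "Eq u t \<in># \<Delta>"
  shows "anchored \<Delta> u" and "t = Var y \<Longrightarrow> nonminimal \<Delta> u"
proof -
  show nm: "nonminimal \<Delta> u" if "t = Var y" for y
  proof -
    have "y < u" using that assms(1,2) by (auto simp: solved_def)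
    then show ?thesis using vclassI(1)[of u y \<Delta>] that t by (auto simp: nonminimal_def)
  qed
  show "anchored \<Delta> u"
    using nm t by (cases t) (auto simp: anchored_def)
qed

section \<open>Solved forms with an equation for the variable\<close>

lemma solved_subsD:
  assumes "solved_subs \<Sigma> u \<alpha> \<phi>s \<phi>s'" "\<chi> \<in> set \<phi>s'"
  shows "\<exists>\<chi>0 \<in> set \<phi>s.
    solves_to \<Sigma> (set_mset \<alpha>) (about u \<alpha> + nbasic \<chi>0) (nbasic \<chi>)"
  using assms by induction auto

text \<open>The equation of \<alpha> for \<open>u\<close> belongs to
  \<open>about u \<alpha>\<close>, so \<open>\<beta>'\<close> has an equation for \<open>u\<close>
  and hence no \<open>Fin u\<close>. If the equation in \<open>\<beta>'\<close> has a generator,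
  \<open>u\<close> was never nonminimal during solving; then the equation of \<alpha> also has a
  generator and, lying in \<alpha>, is kept literally.\<close>

lemma solved_sub_of_Eq:
  assumes \<alpha>: "solved \<Sigma> \<alpha>" and t: "Eq u t \<in># \<alpha>"
    and "solves_to \<Sigma> (set_mset \<alpha>) (about u \<alpha> + \<beta>) \<beta>'"
  shows "Fin u \<notin># \<beta>'" and "Eq u (App g ws) \<in># \<beta>' \<Longrightarrow> Eq u (App g ws) \<in># \<alpha>"
proof -
  have steps: "(solve_step \<Sigma> (set_mset \<alpha>))\<^sup>*\<^sup>* (about u \<alpha> + \<beta>) \<beta>'" and \<beta>': "solved \<Sigma> \<beta>'"
    using assms(3) by (auto simp: solves_to_def)
  have ab: "Eq u t \<in># about u \<alpha> + \<beta>"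
    using t by (auto simp: about_def reachable_def)
  have "anchored \<beta>' u"
    using anchored_Eq(1)[OF \<alpha> t ab] solve_steps_anchored[OF steps] by blast
  then show "Fin u \<notin># \<beta>'"
    using solved_anchored[OF \<beta>'] solved_Eq_Fin[OF \<beta>'] by blast
  assume g: "Eq u (App g ws) \<in># \<beta>'"
  then have "\<not> nonminimal \<beta>' u"
    using solved_nonminimal[OF \<beta>'] solved_Eq_unique[OF \<beta>'] by blast
  then have "\<not> nonminimal (about u \<alpha> + \<beta>) u"
    using solve_steps_nonminimal[OF steps] by blast
  then obtain h zs where h: "t = App h zs"
    using anchored_Eq(2)[OF \<alpha> t ab] by (cases t) auto
  have "Eq u (App h zs) \<in># \<beta>'"
    using solve_steps_keep_App[OF steps] ab t solved_Eq_unique[OF \<alpha> t] \<open>\<not> nonminimal \<beta>' u\<close>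
    unfolding h by blast
  then show "Eq u (App g ws) \<in># \<alpha>"
    using g solved_Eq_unique[OF \<beta>'] t h by blast
qed

text \<open>The preceding lemma refutes \<open>inst_gen\<close> and \<open>inst_inf\<close>, since
  \<open>star\<close> removes the conjuncts of \<alpha>. The equation of \<alpha> itself refutes
  \<open>inst_all\<close> and, as it excludes \<open>Fin u\<close>, also
  \<open>inst_fin\<close>.\<close>

lemma not_instantiable_of_Eq:
  assumes "solved \<Sigma> \<alpha>" "Eq u t \<in># \<alpha>" "solved_subs \<Sigma> u \<alpha> \<phi>s \<phi>s'"
  shows "\<not> instantiable \<Sigma> (NegEx xs \<alpha> \<phi>s') u"
proof -
  have "Fin u \<notin># \<alpha>" using assms solved_Eq_Fin by blast
  moreover have "Fin u \<notin># star \<alpha> (nbasic \<chi>) \<and> Eq u (App g ws) \<notin># star \<alpha> (nbasic \<chi>)"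
    if "\<chi> \<in> set \<phi>s'" for \<chi> g ws
    using solved_subsD[OF assms(3) that] solved_sub_of_Eq[OF assms(1,2)]
    by (auto simp: star_def)
  ultimately show ?thesis
    using assms(2)
    by (auto simp: instantiable_def inst_gen_def inst_all_def inst_fin_def inst_inf_def)
qed

lemma solved_form_anchored_not_instantiable:
  assumes "solved_form \<Sigma> u (NegEx xs \<alpha> \<phi>s) \<phi>'" "anchored \<alpha> u"
  shows "\<not> instantiable \<Sigma> \<phi>' u"
  using assms(1)
proof cases
  case (1 \<alpha>' \<phi>s')
  then have "solved \<Sigma> \<alpha>'" "anchored \<alpha>' u"
    using assms(2) solve_steps_anchored by (auto simp: solves_to_def)
  then show ?thesis
    using not_instantiable_of_Eq solved_anchored 1 by blast
qed

section \<open>A finiteness constraint for a variable without equation\<close>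

text \<open>Every rule requires two conjuncts with the same subject, a variable equation that does
  not descend, or a finiteness constraint on a sort without infinite trees.\<close>

lemma solved_irreducible:
  assumes "solved \<Sigma> \<Gamma>" "solve_step \<Sigma> A \<Gamma> \<Gamma>'"
  shows False
  using assms(2)
proof (cases rule: solve_step.cases)
  case (replace x y t \<Delta>)
  then show ?thesis using assms(1) solved_subjects[of \<Sigma> "Eq x (Var y)" "Eq x t" \<Delta>] by simp
next
  case (decompose x g ws zs \<Delta>)
  then show ?thesis
    using assms(1) solved_subjects[of \<Sigma> "Eq x (App g zs)" "Eq x (App g ws)" \<Delta>] by simp
next
  case (fin_replace x y \<Delta>)
  then show ?thesis using assms(1) solved_subjects[of \<Sigma> "Eq x (Var y)" "Fin x" \<Delta>] by simp
next
  case (fin_decompose x g zs \<Delta>)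
  then show ?thesis using assms(1) solved_subjects[of \<Sigma> "Eq x (App g zs)" "Fin x" \<Delta>] by simp
next
  case (fin_duplicate x \<Delta>)
  then show ?thesis using assms(1) solved_subjects[of \<Sigma> "Fin x" "Fin x" \<Delta>] by simp
next
  case (trivial x)
  then have "Eq x (Var x) \<in># \<Gamma>" by simp
  then show ?thesis using assms(1) unfolding solved_def by blast
next
  case (orient x y)
  then have "Eq x (Var y) \<in># \<Gamma>" by simp
  then show ?thesis using assms(1) orient(3) unfolding solved_def by fastforce
next
  case (fin_trivial x)
  then have "Fin x \<in># \<Gamma>" by simp
  then show ?thesis using assms(1) fin_trivial unfolding solved_def by blast
qed

lemma solved_steps_eq:
  assumes "solved \<Sigma> \<Gamma>" "(solve_step \<Sigma> A)\<^sup>*\<^sup>* \<Gamma> \<Gamma>'"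
  shows "\<Gamma>' = \<Gamma>"
  using assms(2) by (cases rule: converse_rtranclpE) (use solved_irreducible[OF assms(1)] in auto)

text \<open>Otherwise the added constraint could be cancelled, leaving two conjuncts of \<beta> with
  the same subject.\<close>

lemma solved_add_Fin_pair:
  assumes "solved \<Sigma> \<beta>" and eq: "add_mset (Fin u) \<beta> = {# c, d #} + \<Delta>" and "subject c = subject d"
  shows "c = Fin u \<or> d = Fin u"
proof (rule ccontr)
  assume neq: "\<not> ?thesis"
  have "Fin u \<in># {# c, d #} + \<Delta>" by (simp only: eq[symmetric]) simp
  with neq have "Fin u \<in># \<Delta>" by auto
  then obtain \<Delta>' where "\<Delta> = add_mset (Fin u) \<Delta>'" by (auto dest: multi_member_split)
  then have "add_mset (Fin u) \<beta> = add_mset (Fin u) ({# c, d #} + \<Delta>')"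
    using eq by (simp add: add_mset_commute)
  then have "\<beta> = {# c, d #} + \<Delta>'" by simp
  then show False using assms(1,3) solved_subjects by blast
qed

text \<open>A first step has to involve the added \<open>Fin u\<close>: it either merges it with a
  copy in \<beta> or pushes it through a generator equation, which presupposes that \<open>u\<close>
  lies on no cycle.\<close>

lemma solve_step_add_Fin:
  assumes "solved \<Sigma> \<beta>" "inf_trees \<Sigma> (var_sort \<Sigma> u) \<noteq> {}"
    and "solve_step \<Sigma> A (add_mset (Fin u) \<beta>) \<Gamma>'"
    and noVar: "\<And>y. Eq u (Var y) \<notin># \<beta>"
  shows "\<Gamma>' = \<beta> \<and> Fin u \<in># \<beta> \<or>
    (\<exists>g zs. Eq u (App g zs) \<in># \<beta> \<and> \<not> properly_reachable \<beta> u u)"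
  using assms(3)
proof (cases rule: solve_step.cases)
  case (trivial x)
  then have "Eq x (Var x) \<in># add_mset (Fin u) \<beta>" by simp
  then show ?thesis using assms(1) by (auto simp: solved_def)
next
  case (orient x y \<Delta>)
  then have "Eq x (Var y) \<in># add_mset (Fin u) \<beta>" by simp
  then show ?thesis using assms(1) orient(3) by (fastforce simp: solved_def)
next
  case (replace x y t \<Delta>)
  then show ?thesis using solved_add_Fin_pair[OF assms(1) replace(1)] by simp
next
  case (decompose x g ws zs \<Delta>)
  then show ?thesis using solved_add_Fin_pair[OF assms(1) decompose(1)] by simp
next
  case (fin_replace x y \<Delta>)
  then have "x = u" using solved_add_Fin_pair[OF assms(1) fin_replace(1)] by simp
  then have "\<beta> = {# Eq u (Var y) #} + \<Delta>" using fin_replace(1) by (simp add: add_mset_commute)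
  then show ?thesis using noVar[of y] by simp
next
  case (fin_decompose x g zs \<Delta>)
  then have x: "x = u" using solved_add_Fin_pair[OF assms(1) fin_decompose(1)] by simp
  then have "\<beta> = {# Eq u (App g zs) #} + \<Delta>"
    using fin_decompose(1) by (simp add: add_mset_commute)
  then show ?thesis using fin_decompose(3) x by auto
next
  case (fin_duplicate x \<Delta>)
  then have x: "x = u" using solved_add_Fin_pair[OF assms(1) fin_duplicate(1)] by simp
  then have "\<beta> = {# Fin u #} + \<Delta>" using fin_duplicate(1) by simp
  then show ?thesis using fin_duplicate(2) x by simp
next
  case (fin_trivial x)
  then have "Fin x \<in># add_mset (Fin u) \<beta>" by simp
  then have "x \<noteq> u \<Longrightarrow> Fin x \<in># \<beta>" by simp
  then show ?thesis using assms(1,2) fin_trivial unfolding solved_def by blast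
qed

text \<open>Traces the hypotheses of \<open>inst_gen\<close> after solving back to the formula
  before solving. The other outcomes leave \<open>Fin u\<close> next to an equation for
  \<open>u\<close> in a solved formula.\<close>

lemma solves_to_add_Fin_App:
  assumes \<beta>: "solved \<Sigma> \<beta>" and inf: "inf_trees \<Sigma> (var_sort \<Sigma> u) \<noteq> {}"
    and "solves_to \<Sigma> A (add_mset (Fin u) \<beta>) \<beta>'" and g: "Eq u (App g ws) \<in># \<beta>'"
  shows "(\<exists>h zs. Eq u (App h zs) \<in># \<beta>) \<and> \<not> properly_reachable \<beta> u u"
proof -
  have steps: "(solve_step \<Sigma> A)\<^sup>*\<^sup>* (add_mset (Fin u) \<beta>) \<beta>'" and \<beta>': "solved \<Sigma> \<beta>'"
    using assms(3) by (auto simp: solves_to_def)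
  \<comment> \<open>A variable equation for \<open>u\<close> would keep \<open>u\<close> nonminimal,
    and \<open>\<beta>'\<close> would have a variable equation besides
    \<open>u = g(ws)\<close>.\<close>
  have noVar: "Eq u (Var y) \<notin># \<beta>" for y
  proof
    assume y: "Eq u (Var y) \<in># \<beta>"
    then have "nonminimal (add_mset (Fin u) \<beta>) u"
      by (intro anchored_Eq(2)[OF \<beta> y]) auto
    then have "nonminimal \<beta>' u" using solve_steps_nonminimal[OF steps] by blast
    then show False
      using solved_nonminimal[OF \<beta>'] solved_Eq_unique[OF \<beta>' g] by blast
  qed
  show ?thesis
    using steps
  proof (cases rule: converse_rtranclpE)
    case base
    then show ?thesis
      using g solved_Eq_Fin[OF \<beta>' g] by auto
  next
    case (step \<Gamma>)
    from solve_step_add_Fin[OF \<beta> inf step(1) noVar] show ?thesis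
    proof
      assume "\<Gamma> = \<beta> \<and> Fin u \<in># \<beta>"
      then have "\<beta>' = \<beta>" "Fin u \<in># \<beta>" using solved_steps_eq[OF \<beta>] step(2) by auto
      then show ?thesis using g solved_Eq_Fin[OF \<beta>] by auto
    qed blast
  qed
qed

lemma about_without_Eq:
  assumes "\<nexists>t. Eq u t \<in># \<alpha>"
  shows "about u \<alpha> = {# c \<in># \<alpha>. subject c = u #}"
proof -
  have "reachable \<alpha> u x \<longleftrightarrow> x = u" for x
  proof
    assume "reachable \<alpha> u x"
    then show "x = u"
      unfolding reachable_def by (cases rule: converse_rtranclE) (use assms in \<open>auto simp: edges_def\<close>)
  qed (simp add: reachable_def)
  then show ?thesis by (simp add: about_def)
qed

lemma solved_form_Fin_not_instantiable:
  assumes form: "solved_form \<Sigma> u (NegEx xs (\<alpha> + {# Fin u #}) \<phi>s) \<phi>'"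
    and \<alpha>: "solved \<Sigma> \<alpha>" and subs: "\<forall>\<chi> \<in> set \<phi>s. solved \<Sigma> (nbasic \<chi>)"
    and inst: "\<not> inst_gen \<Sigma> (NegEx xs \<alpha> \<phi>s) u" "\<not> inst_all \<Sigma> (NegEx xs \<alpha> \<phi>s) u"
      "inst_inf \<Sigma> (NegEx xs \<alpha> \<phi>s) u"
  shows "\<not> instantiable \<Sigma> \<phi>' u"
proof (cases "\<exists>t. Eq u t \<in># \<alpha>")
  case True
  then obtain t where t: "Eq u t \<in># \<alpha>" by blast
  then have "anchored (\<alpha> + {# Fin u #}) u" by (intro anchored_Eq(1)[OF \<alpha> t]) auto
  then show ?thesis using solved_form_anchored_not_instantiable[OF form] by blast
next
  case False
  obtain \<chi>0 where \<chi>0: "\<chi>0 \<in> set \<phi>s" "Fin u \<in># nbasic \<chi>0" "Fin u \<notin># \<alpha>"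
    and FI: "var_sort \<Sigma> u \<in> S_FI \<Sigma>"
    using inst(3) by (auto simp: inst_inf_def star_def)
  have mixed: "fin_trees \<Sigma> (var_sort \<Sigma> u) \<noteq> {}" "inf_trees \<Sigma> (var_sort \<Sigma> u) \<noteq> {}"
    using subs \<chi>0 by (auto simp: solved_def)
  have "u \<in> basic_vars (star \<alpha> (nbasic \<chi>0))"
    using \<chi>0 by (force simp: basic_vars_def star_def)
  \<comment> \<open>Otherwise \<open>inst_all\<close> would have applied. Being outside
    \<open>S_FF\<close> also excludes \<open>inst_all\<close> and \<open>inst_fin\<close> for the
    result.\<close>
  then have FF: "var_sort \<Sigma> u \<notin> S_FF \<Sigma>"
    using inst(2) FI \<chi>0(1) False by (auto simp: inst_all_def)
  have no_u: "{# c \<in># \<alpha>. subject c = u #} = {#}"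
  proof -
    have "subject c \<noteq> u" if "c \<in># \<alpha>" for c
      using that False \<chi>0(3) by (cases c) auto
    then show ?thesis by simp
  qed
  have solved': "solved \<Sigma> (\<alpha> + {# Fin u #})"
    using \<alpha> no_u mixed False unfolding solved_def by auto
  from form obtain \<phi>s' where \<phi>': "\<phi>' = NegEx xs (\<alpha> + {# Fin u #}) \<phi>s'"
    and subs': "solved_subs \<Sigma> u (\<alpha> + {# Fin u #}) \<phi>s \<phi>s'"
    by cases (use solved_steps_eq[OF solved'] in \<open>auto simp: solves_to_def\<close>)
  have about: "about u (\<alpha> + {# Fin u #}) = {# Fin u #}"
    using about_without_Eq[of u "\<alpha> + {# Fin u #}"] False no_u by auto
  \<comment> \<open>Such an equation traces back to a subformula in which \<open>u\<close> has a
    generator equation and lies on no cycle. As \<alpha> has no equation for \<open>u\<close>,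
    \<open>star\<close> keeps it, and \<open>inst_gen\<close> would have applied.\<close>
  have "\<not> (finite (gens \<Sigma> (var_sort \<Sigma> u)) \<and> Eq u (App g ws) \<in># nbasic \<chi>)"
    if \<chi>: "\<chi> \<in> set \<phi>s'" for \<chi> g ws
  proof
    assume g: "finite (gens \<Sigma> (var_sort \<Sigma> u)) \<and> Eq u (App g ws) \<in># nbasic \<chi>"
    obtain \<chi>1 where \<chi>1: "\<chi>1 \<in> set \<phi>s"
      "solves_to \<Sigma> (set_mset (\<alpha> + {# Fin u #})) (add_mset (Fin u) (nbasic \<chi>1)) (nbasic \<chi>)"
      using solved_subsD[OF subs' \<chi>] about by auto
    obtain h zs where "Eq u (App h zs) \<in># nbasic \<chi>1" "\<not> properly_reachable (nbasic \<chi>1) u u"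
      using solves_to_add_Fin_App[OF _ mixed(2) \<chi>1(2)] subs \<chi>1(1) g by blast
    then show False
      using inst(1) g \<chi>1(1) False by (auto simp: inst_gen_def star_def)
  qed
  \<comment> \<open>\<open>inst_inf\<close> fails because \<open>Fin u\<close> now belongs to the
    outer basic formula and is removed by \<open>star\<close>.\<close>
  then show ?thesis
    using FF by (auto simp: \<phi>' instantiable_def inst_gen_def inst_all_def inst_fin_def
        inst_inf_def star_def)
qed

section \<open>Termination of solving\<close>

fun is_eq :: "('g, 'v) conjunct \<Rightarrow> bool" where
  "is_eq (Eq x t) \<longleftrightarrow> True"
| "is_eq (Fin x) \<longleftrightarrow> False"

abbreviation eqs :: "('g, 'v) basic \<Rightarrow> ('g, 'v) basic" where
  "eqs \<Gamma> \<equiv> {# c \<in># \<Gamma>. is_eq c #}"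

definition solved_eqs :: "('g, 'v::linorder) basic \<Rightarrow> bool" where
  "solved_eqs \<Gamma> \<longleftrightarrow>
     (\<forall>x. size {# c \<in># \<Gamma>. subject c = x #} \<le> 1) \<and> (\<forall>x y. Eq x (Var y) \<in># \<Gamma> \<longrightarrow> x > y)"

fun app_count :: "('g, 'v) conjunct \<Rightarrow> nat" where
  "app_count (Eq x (App g zs)) = 1"
| "app_count _ = 0"

text \<open>The factor 2 lets a drop in rank outweigh the change of the orientation summand, which
  is at most 1.\<close>

fun weight :: "('v::linorder \<Rightarrow> nat) \<Rightarrow> ('g, 'v) conjunct \<Rightarrow> nat" where
  "weight r (Eq x (Var y)) = 2 * (r x + r y) + (if x < y then 2 else 1)"
| "weight r (Eq x (App g zs)) = r x"
| "weight r (Fin x) = 0"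

text \<open>Decomposition uses up an equation with a generator, and replacement lowers the rank of the
  subject. The last summand of the weight of \<open>x = y\<close> accounts for orientation and for trivial
  equations.\<close>

definition eqs_order ::
    "('v::linorder \<Rightarrow> nat) \<Rightarrow> (('g, 'v) basic \<times> ('g, 'v) basic) set" where
  "eqs_order r = measures [\<lambda>\<Gamma>. \<Sum>c \<in># \<Gamma>. app_count c, \<lambda>\<Gamma>. \<Sum>c \<in># \<Gamma>. weight r c]"

text \<open>Equations that do not descend are treated first. Once all descend, an unsolved
  equational part must contain two equations with the same subject, to which replacement or
  decomposition applies.\<close>

lemma eqs_step_exists:
  fixes \<Gamma> :: "('g, 'v::linorder) basic"
  assumes "\<not> solved_eqs (eqs \<Gamma>)" "\<not> clash \<Sigma> \<Gamma>"
    and r: "\<And>x y. x \<in> basic_vars \<Gamma> \<Longrightarrow> x < y \<Longrightarrow> r x < r y"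
  shows "\<exists>\<Gamma>'. solve_step \<Sigma> A \<Gamma> \<Gamma>' \<and> basic_vars \<Gamma>' \<subseteq> basic_vars \<Gamma> \<and> (\<Gamma>', \<Gamma>) \<in> eqs_order r"
proof (cases "\<exists>x y. Eq x (Var y) \<in># \<Gamma> \<and> \<not> x > y")
  case True
  then obtain x y where "Eq x (Var y) \<in># \<Gamma>" and xy: "\<not> x > y" by blast
  then obtain \<Delta> where \<Delta>: "\<Gamma> = {# Eq x (Var y) #} + \<Delta>" by (auto dest: multi_member_split)
  show ?thesis
  proof (cases "x = y")
    case True
    then show ?thesis
      unfolding \<Delta> using solve_step.trivial[of \<Sigma> A x \<Delta>]
      by (intro exI[of _ \<Delta>] conjI) (auto simp: eqs_order_def)
  next
    case False
    with xy have "x < y" by simp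
    then show ?thesis
      unfolding \<Delta> using solve_step.orient[of x y \<Sigma> A \<Delta>]
      by (intro exI[of _ "{# Eq y (Var x) #} + \<Delta>"] conjI) (auto simp: eqs_order_def)
  qed
next
  case False
  then have oriented: "y < x" if "Eq x (Var y) \<in># \<Gamma>" for x y using that by blast
  then have "\<not> (\<forall>x. size {# c \<in># eqs \<Gamma>. subject c = x #} \<le> 1)"
    using assms(1) by (auto simp: solved_eqs_def)
  then obtain c d \<Delta>' where cd: "eqs \<Gamma> = {# c, d #} + \<Delta>'" "subject c = subject d"
    unfolding subjects_distinct_iff by blast
  moreover obtain K where K: "\<Gamma> = eqs \<Gamma> + K"
    using multiset_partition[of \<Gamma> is_eq] by blast
  ultimately have "\<Gamma> = {# c, d #} + (\<Delta>' + K)" by (metis add.assoc)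
  moreover have "c \<in># eqs \<Gamma>" "d \<in># eqs \<Gamma>" using cd(1) by simp_all
  then have "is_eq c" "is_eq d" by simp_all
  ultimately obtain x s t \<Delta> where \<Gamma>: "\<Gamma> = {# Eq x s, Eq x t #} + \<Delta>"
    using cd(2) by (cases c; cases d) auto
  have replace: ?thesis if \<Gamma>: "\<Gamma> = {# Eq x (Var y), Eq x t #} + \<Delta>" for y t
  proof -
    have "y < x" using oriented \<Gamma> by auto
    have "r y < r x" using r[of y x] \<open>y < x\<close> by (auto simp: \<Gamma>)
    have "solve_step \<Sigma> A \<Gamma> ({# Eq x (Var y), Eq y t #} + \<Delta>)"
      unfolding \<Gamma> by (rule solve_step.replace) fact
    moreover have "({# Eq x (Var y), Eq y t #} + \<Delta>, \<Gamma>) \<in> eqs_order r"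
      using \<open>r y < r x\<close> by (cases t) (auto simp: eqs_order_def \<Gamma>)
    ultimately show ?thesis
      by (intro exI[of _ "{# Eq x (Var y), Eq y t #} + \<Delta>"]) (auto simp: \<Gamma>)
  qed
  show ?thesis
  proof (cases s)
    case (Var y)
    then show ?thesis using replace \<Gamma> by blast
  next
    case s: (App g zs)
    show ?thesis
    proof (cases t)
      case (Var y)
      then show ?thesis using replace[of y s] \<Gamma> by (simp add: add_mset_commute)
    next
      case t: (App h ws)
      have "g = h"
        using assms(2) \<Gamma> s t by (auto simp: clash_def)
      have decompose: ?thesis
        if \<Gamma>: "\<Gamma> = {# Eq x (App g zs), Eq x (App g ws) #} + \<Delta>"
          and A: "Eq x (App g ws) \<in> A \<Longrightarrow> Eq x (App g zs) \<in> A" for zs ws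
      proof -
        let ?eqs = "mset (map2 (\<lambda>z w. Eq z (Var w)) zs ws) :: ('g, 'v) basic"
        let ?\<Gamma>' = "{# Eq x (App g zs) #} + ?eqs + \<Delta>"
        have "solve_step \<Sigma> A \<Gamma> ?\<Gamma>'"
          unfolding \<Gamma> by (rule solve_step.decompose) (rule A)
        moreover have "basic_vars ?eqs \<subseteq> set zs \<union> set ws"
          by (auto simp: basic_vars_def dest: set_zip_leftD set_zip_rightD)
        then have "basic_vars ?\<Gamma>' \<subseteq> basic_vars \<Gamma>"
          by (auto simp: \<Gamma>)
        moreover have "(\<Sum>c \<in># ?eqs. app_count c) = 0" by auto
        then have "(?\<Gamma>', \<Gamma>) \<in> eqs_order r" by (auto simp: eqs_order_def \<Gamma>)
        ultimately show ?thesis by blast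
      qed
      \<comment> \<open>In one of the two orders the side condition on \<open>A\<close> holds: an
        equation in \<open>A\<close> is chosen as the one to keep.\<close>
      show ?thesis
        using decompose[of zs ws] decompose[of ws zs] \<Gamma> s t \<open>g = h\<close>
        by (auto simp: add_mset_commute)
    qed
  qed
qed

lemma solve_eqs_exists:
  fixes \<Gamma> :: "('g, 'v::linorder) basic"
  shows "\<exists>\<Gamma>'. (solve_step \<Sigma> A)\<^sup>*\<^sup>* \<Gamma> \<Gamma>' \<and> (clash \<Sigma> \<Gamma>' \<or> solved_eqs (eqs \<Gamma>'))"
proof -
  define V where "V = basic_vars \<Gamma>"
  \<comment> \<open>The variable order need not be well-founded. Solving the equations introduces no
    variables, so counting the smaller ones in the initial finite set gives a rank that serves
    throughout.\<close>
  define r where "r x = card {v \<in> V. v < x}" for x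
  have "finite (conjunct_vars c)" for c :: "('g, 'v) conjunct"
    by (cases c) (auto, metis List.finite_set finite.simps rhs.exhaust rhs_vars.simps)
  then have "finite V" by (auto simp: V_def basic_vars_def)
  have r: "r x < r y" if "x \<in> V" "x < y" for x y
    unfolding r_def using that \<open>finite V\<close> by (intro psubset_card_mono) auto
  have "wf (eqs_order r :: (('g, 'v) basic \<times> ('g, 'v) basic) set)" by (simp add: eqs_order_def)
  moreover have "basic_vars \<Gamma> \<subseteq> V" by (simp add: V_def)
  ultimately show ?thesis
  proof (induction \<Gamma> rule: wf_induct_rule)
    case (less \<Gamma>)
    show ?case
    proof (cases "solved_eqs (eqs \<Gamma>) \<or> clash \<Sigma> \<Gamma>")
      case False
      then obtain \<Gamma>' where "solve_step \<Sigma> A \<Gamma> \<Gamma>'" "basic_vars \<Gamma>' \<subseteq> V" "(\<Gamma>', \<Gamma>) \<in> eqs_order r"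
        using eqs_step_exists[of \<Gamma> \<Sigma> r A] r less.prems by blast
      then show ?thesis
        using less.IH by (meson converse_rtranclp_into_rtranclp)
    qed blast
  qed
qed

text \<open>A finiteness constraint either descends in the order of the variables or leaves a variable
  that cannot be reached again.\<close>

definition fin_order :: "('v::linorder \<times> 'v) set \<Rightarrow> ('v \<times> 'v) set" where
  "fin_order E = {(y, x). (x, y) \<in> E \<and> (y < x \<or> (x, x) \<notin> E\<^sup>+)}"

text \<open>Along an edge the set of reachable vertices cannot grow, and it shrinks if the source
  lies on no cycle. On a cycle the target is smaller, so the number of vertices below decreases. The
  two numbers are compared lexicographically.\<close>

lemma wf_fin_order:
  assumes "finite E"
  shows "wf (fin_order E)"
proof -
  let ?reach = "\<lambda>x. E\<^sup>* `` {x}" and ?below = "\<lambda>x. {v \<in> Field E. v < x}"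
  have fin: "finite (?reach x)" for x
  proof (rule finite_subset)
    show "?reach x \<subseteq> insert x (Field E)"
      by (auto elim: rtranclE simp: Field_def)
  qed (simp add: assms finite_Field)
  have "fin_order E \<subseteq> measures [\<lambda>x. card (?reach x), \<lambda>x. card (?below x)]"
  proof (rule subrelI)
    fix y x assume "(y, x) \<in> fin_order E"
    then have yx: "(x, y) \<in> E" and or: "y < x \<or> (x, x) \<notin> E\<^sup>+" by (auto simp: fin_order_def)
    have sub: "?reach y \<subseteq> ?reach x" using yx by auto
    then have le: "card (?reach y) \<le> card (?reach x)" using fin by (intro card_mono) auto
    show "(y, x) \<in> measures [\<lambda>x. card (?reach x), \<lambda>x. card (?below x)]"
    proof (cases "(x, x) \<in> E\<^sup>+")
      case False
      then have "x \<notin> ?reach y" using yx by (auto dest: rtrancl_into_trancl2)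
      then have "?reach y \<subset> ?reach x" using sub by auto
      then show ?thesis using fin by (auto intro: psubset_card_mono)
    next
      case True
      then have "y < x" using or by blast
      then have "?below y \<subset> ?below x" using yx by (auto simp: Field_def)
      then have "card (?below y) < card (?below x)"
        using assms by (intro psubset_card_mono) (auto simp: finite_Field)
      then show ?thesis using le by auto
    qed
  qed
  then show ?thesis by (rule wf_subset[rotated]) simp
qed

lemma edges_eqs: "edges (eqs \<Gamma>) = edges \<Gamma>"
  by (auto simp: edges_def)

lemma finite_edges: "finite (edges \<Gamma>)"
proof (rule finite_subset)
  show "edges \<Gamma> \<subseteq> (\<Union>c \<in> set_mset \<Gamma>. case c of Eq x t \<Rightarrow> {x} \<times> rhs_vars t | Fin x \<Rightarrow> {})"
    by (force simp: edges_def)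
  have "finite (rhs_vars t)" for t :: "('g, 'v) rhs" by (cases t) auto
  then show "finite (\<Union>c \<in> set_mset \<Gamma>. case c of Eq x t \<Rightarrow> {x} \<times> rhs_vars t | Fin x \<Rightarrow> {})"
    by (auto split: conjunct.split)
qed

text \<open>Each step replaces one constraint by finitely many whose subjects are smaller in
  \<open>fin_order\<close>, or by none, which is a descent in the multiset order.\<close>

lemma fin_step_exists:
  assumes "solved_eqs (eqs \<Gamma>)" "\<not> solved \<Sigma> \<Gamma>" "\<not> clash \<Sigma> \<Gamma>"
  shows "\<exists>\<Gamma>'. solve_step \<Sigma> A \<Gamma> \<Gamma>' \<and> eqs \<Gamma>' = eqs \<Gamma> \<and>
    (\<Gamma>', \<Gamma>) \<in> mult (inv_image (fin_order (edges \<Gamma>)) subject)"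
    (is "\<exists>\<Gamma>'. ?P \<Gamma>'")
proof -
  let ?R = "inv_image (fin_order (edges \<Gamma>)) subject"
  have mult: "(\<Gamma>', \<Gamma>) \<in> mult ?R"
    if "\<Gamma> = add_mset c \<Delta>" "\<Gamma>' = \<Delta> + K" "\<And>d. d \<in># K \<Longrightarrow> (d, c) \<in> ?R" for c \<Delta> K \<Gamma>'
    using mult1I[OF that] unfolding mult_def by (rule r_into_trancl)
  have both: ?thesis if \<Gamma>: "\<Gamma> = {# Eq x t, Fin x #} + \<Delta>" for x t \<Delta>
  proof (cases t)
    case (Var y)
    then have yx: "y < x" using assms(1) \<Gamma> by (auto simp: solved_eqs_def)
    have "?P ({# Eq x (Var y), Fin y #} + \<Delta>)"
    proof (intro conjI)
      show "solve_step \<Sigma> A \<Gamma> ({# Eq x (Var y), Fin y #} + \<Delta>)"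
        unfolding \<Gamma> Var by (rule solve_step.fin_replace) fact
      have "(x, y) \<in> edges \<Gamma>" using Var by (auto simp: \<Gamma> edges_def)
      then show "({# Eq x (Var y), Fin y #} + \<Delta>, \<Gamma>) \<in> mult ?R"
        using yx Var
        by (intro mult[of "Fin x" "add_mset (Eq x t) \<Delta>" _ "{# Fin y #}"])
          (auto simp: \<Gamma> fin_order_def)
    qed (simp add: \<Gamma> Var)
    then show ?thesis by blast
  next
    case (App g zs)
    have edges: "edges ({# Eq x (App g zs) #} + \<Delta>) = edges \<Gamma>"
      by (auto simp: \<Gamma> App edges_def)
    have "Eq x (App g zs) \<in># \<Gamma>" "Fin x \<in># \<Gamma>" by (auto simp: \<Gamma> App)
    then have acyclic: "\<not> properly_reachable \<Gamma> x x"
      using assms(3) unfolding clash_def by blast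
    let ?\<Gamma>' = "{# Eq x (App g zs) #} + mset (map Fin zs) + \<Delta>"
    have "?P ?\<Gamma>'"
    proof (intro conjI)
      show "solve_step \<Sigma> A \<Gamma> ?\<Gamma>'"
        unfolding \<Gamma> App
        by (rule solve_step.fin_decompose) (use acyclic edges in \<open>simp add: properly_reachable_def\<close>)
      have "(x, z) \<in> edges \<Gamma>" if "z \<in> set zs" for z
        using that by (auto simp: \<Gamma> App edges_def)
      then show "(?\<Gamma>', \<Gamma>) \<in> mult ?R"
        using acyclic App
        by (intro mult[of "Fin x" "add_mset (Eq x t) \<Delta>" _ "mset (map Fin zs)"])
          (auto simp: \<Gamma> fin_order_def properly_reachable_def)
      have "eqs (mset (map Fin zs)) = {#}" by auto
      then show "eqs ?\<Gamma>' = eqs \<Gamma>" by (simp add: \<Gamma> App)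
    qed
    then show ?thesis by blast
  qed
  \<comment> \<open>Orientation is part of \<open>solved_eqs\<close>, and a constraint on a sort
    without finite trees would be a clash. Only these two defects remain.\<close>
  consider (dup) c d \<Delta> where "\<Gamma> = {# c, d #} + \<Delta>" "subject c = subject d"
    | (triv) x where "Fin x \<in># \<Gamma>" "inf_trees \<Sigma> (var_sort \<Sigma> x) = {}"
  proof -
    have "\<forall>x y. Eq x (Var y) \<in># \<Gamma> \<longrightarrow> x > y" using assms(1) by (auto simp: solved_eqs_def)
    moreover have "\<forall>x. Fin x \<in># \<Gamma> \<longrightarrow> fin_trees \<Sigma> (var_sort \<Sigma> x) \<noteq> {}"
      using assms(3) unfolding clash_def by blast
    ultimately show thesis
      using assms(2) that unfolding solved_def subjects_distinct_iff by blast
  qed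
  then show ?thesis
  proof cases
    case triv
    then obtain \<Delta> where \<Gamma>: "\<Gamma> = {# Fin x #} + \<Delta>" by (auto dest: multi_member_split)
    have "?P \<Delta>"
      using triv solve_step.fin_trivial[of \<Sigma> x A \<Delta>] mult[of "Fin x" \<Delta> \<Delta> "{#}"] by (simp add: \<Gamma>)
    then show ?thesis by blast
  next
    case dup
    show ?thesis
    proof (cases c)
      case c: (Eq x t)
      show ?thesis
      proof (cases d)
        case (Eq y s)
        then have "eqs \<Gamma> = {# c, d #} + eqs \<Delta>" using dup c by simp
        then show ?thesis
          using assms(1) dup(2) unfolding solved_eqs_def subjects_distinct_iff by blast
      next
        case (Fin y)
        then show ?thesis using both[of x t \<Delta>] dup c by simp
      qed
    next
      case c: (Fin x)
      show ?thesis
      proof (cases d)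
        case (Eq y s)
        then show ?thesis using both[of y s \<Delta>] dup c by (simp add: add_mset_commute)
      next
        case (Fin y)
        then have \<Gamma>: "\<Gamma> = {# Fin x, Fin x #} + \<Delta>" using dup c by simp
        have "?P ({# Fin x #} + \<Delta>)"
          using solve_step.fin_duplicate[of \<Sigma> A x \<Delta>]
            mult[of "Fin x" "{# Fin x #} + \<Delta>" "{# Fin x #} + \<Delta>" "{#}"] by (simp add: \<Gamma>)
        then show ?thesis by blast
      qed
    qed
  qed
qed

section \<open>Existence of solved forms\<close>

lemma solve_exists:
  fixes \<Gamma> :: "('g, 'v::linorder) basic"
  shows "\<exists>\<Gamma>'. (solve_step \<Sigma> A)\<^sup>*\<^sup>* \<Gamma> \<Gamma>' \<and> (clash \<Sigma> \<Gamma>' \<or> solved \<Sigma> \<Gamma>')"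
proof -
  obtain \<Gamma>1 where \<Gamma>1: "(solve_step \<Sigma> A)\<^sup>*\<^sup>* \<Gamma> \<Gamma>1" "clash \<Sigma> \<Gamma>1 \<or> solved_eqs (eqs \<Gamma>1)"
    using solve_eqs_exists[of \<Sigma> A \<Gamma>] by blast
  have "\<exists>\<Gamma>'. (solve_step \<Sigma> A)\<^sup>*\<^sup>* \<Gamma>1 \<Gamma>' \<and> (clash \<Sigma> \<Gamma>' \<or> solved \<Sigma> \<Gamma>')"
    if "solved_eqs (eqs \<Gamma>1)"
  proof -
    \<comment> \<open>The steps of the second phase preserve the equations and therefore the graph,
      so a single well-founded order serves for all of them.\<close>
    define E where "E = edges \<Gamma>1"
    have "wf (mult (inv_image (fin_order E) (subject :: ('g, 'v) conjunct \<Rightarrow> 'v)))"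
      unfolding E_def by (intro wf_mult wf_inv_image wf_fin_order finite_edges)
    moreover have "edges \<Gamma>1 = E" by (simp add: E_def)
    moreover note that
    ultimately show ?thesis
    proof (induction \<Gamma>1 rule: wf_induct_rule)
      case (less \<Delta>)
      show ?case
      proof (cases "clash \<Sigma> \<Delta> \<or> solved \<Sigma> \<Delta>")
        case False
        then obtain \<Delta>' where "solve_step \<Sigma> A \<Delta> \<Delta>'" "eqs \<Delta>' = eqs \<Delta>"
          "(\<Delta>', \<Delta>) \<in> mult (inv_image (fin_order (edges \<Delta>)) subject)"
          using fin_step_exists[OF less.prems(2)] by blast
        moreover from this have "edges \<Delta>' = edges \<Delta>" by (metis edges_eqs)
        ultimately obtain \<Gamma>' where "(solve_step \<Sigma> A)\<^sup>*\<^sup>* \<Delta>' \<Gamma>'" "clash \<Sigma> \<Gamma>' \<or> solved \<Sigma> \<Gamma>'"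
          using less.IH[of \<Delta>'] less.prems by auto
        with \<open>solve_step \<Sigma> A \<Delta> \<Delta>'\<close> show ?thesis
          by (blast intro: converse_rtranclp_into_rtranclp)
      qed blast
    qed
  qed
  then obtain \<Gamma>2 where "(solve_step \<Sigma> A)\<^sup>*\<^sup>* \<Gamma>1 \<Gamma>2" "clash \<Sigma> \<Gamma>2 \<or> solved \<Sigma> \<Gamma>2"
    using \<Gamma>1(2) by blast
  then show ?thesis using rtranclp_trans[OF \<Gamma>1(1)] by blast
qed

lemma solved_subs_exists: "\<exists>\<phi>s'. solved_subs \<Sigma> u \<alpha> \<phi>s \<phi>s'"
proof (induction \<phi>s)
  case Nil
  then show ?case by (blast intro: solved_subs.intros)
next
  case (Cons \<chi> \<phi>s)
  obtain ys \<beta> \<chi>s where "\<chi> = NegEx ys \<beta> \<chi>s" by (cases \<chi>)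
  then show ?case
    using Cons solve_exists[of \<Sigma> "set_mset \<alpha>" "about u \<alpha> + \<beta>"] solved_subs.intros(2,3)
    unfolding solves_to_def solving_fails_def by metis
qed

lemma solved_form_exists:
  "solving_fails \<Sigma> {} \<alpha> \<or> (\<exists>\<phi>'. solved_form \<Sigma> u (NegEx xs \<alpha> \<phi>s) \<phi>')"
  using solve_exists[of \<Sigma> "{}" \<alpha>] solved_subs_exists[of \<Sigma> u _ \<phi>s] solved_form.intros
  unfolding solves_to_def solving_fails_def by metis

section \<open>Instantiations\<close>

lemma anchored_App: "Eq u (App g zs) \<in># \<Gamma> \<Longrightarrow> anchored \<Gamma> u"
  unfolding anchored_def by blast

lemma fresh_choice_fl:
  assumes "fresh_choice \<Sigma> \<phi> fz fl" "u \<in> all_vars \<phi>" "trm_of_sort \<Sigma> (var_sort \<Sigma> u) t"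
    and "fl u t = (zs, \<Gamma>)"
  shows "flat u t zs \<Gamma>" "well_sorted_basic \<Sigma> \<Gamma>" "distinct zs"
    "set zs \<inter> (all_vars \<phi> \<union> trm_vars t \<union> uvar \<Sigma> ` S_1I \<Sigma>) = {}"
  using assms unfolding fresh_choice_def by blast+

lemma fresh_choice_fz:
  assumes "fresh_choice \<Sigma> \<phi> fz fl"
  shows "distinct (fz g)" "map (var_sort \<Sigma>) (fz g) = gen_args \<Sigma> g"
    "set (fz g) \<inter> all_vars \<phi> = {}"
  using assms unfolding fresh_choice_def by blast+

text \<open>Finiteness of the sets of equations matters here: \<open>mset_set\<close> of an infinite
  set is empty.\<close>

lemma set_mset_ueqs:
  assumes "admissible \<Sigma>"
  shows "c \<in># (\<Sum>s \<leftarrow> one_inf \<Sigma>. mset_set (ueqs \<Sigma> s)) \<longleftrightarrow> (\<exists>s \<in> S_1I \<Sigma>. c \<in> ueqs \<Sigma> s)"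
proof -
  have "c \<in># (\<Sum>s \<leftarrow> ss. mset_set (ueqs \<Sigma> s)) \<longleftrightarrow> (\<exists>s \<in> set ss. c \<in># mset_set (ueqs \<Sigma> s))" for ss
    by (induction ss) auto
  moreover have "set (one_inf \<Sigma>) = S_1I \<Sigma>"
    using assms by (rule admissible_one_inf)
  ultimately show ?thesis using admissible_uvar(2)[OF assms] by auto
qed

lemma with_ueqs_vars:
  assumes "admissible \<Sigma>"
  shows "set (fst (with_ueqs \<Sigma> (zs, \<Gamma>))) = uvar \<Sigma> ` S_1I \<Sigma> \<union> set zs"
  using admissible_one_inf[OF assms] by (simp add: with_ueqs_def)

text \<open>A term with a generator at its root gives \<open>u\<close> a generator equation. A bare
  variable \<open>u_r\<close> joins the class of \<open>u\<close> and contributes its own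
  equation.\<close>

lemma anchored_flat_with_ueqs:
  assumes adm: "admissible \<Sigma>" and "flat u t zs \<Gamma>" "trm_vars t \<subseteq> uvar \<Sigma> ` S_1I \<Sigma>"
  shows "anchored (\<alpha> + snd (with_ueqs \<Sigma> (zs, \<Gamma>))) u"
  using assms(2)
proof cases
  case (1 w)
  then obtain r where r: "r \<in> S_1I \<Sigma>" "w = uvar \<Sigma> r" using assms(3) by auto
  then obtain g zs' where "Eq w (App g zs') \<in># snd (with_ueqs \<Sigma> (zs, \<Gamma>))"
    using uvar_has_equation[OF adm r(1)] set_mset_ueqs[OF adm] by (auto simp: with_ueqs_def)
  moreover have "(u, w) \<in> vclass (\<alpha> + snd (with_ueqs \<Sigma> (zs, \<Gamma>)))"
    using 1 by (intro vclassI) (auto simp: with_ueqs_def)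
  ultimately show ?thesis unfolding anchored_def by (metis union_iff)
next
  case (2 ws ts \<Gamma>' g)
  then show ?thesis
    by (intro anchored_App[of u g ws]) (auto simp: with_ueqs_def)
qed

lemma anchored_flat_ground:
  assumes "flat u t zs \<Gamma>" "trm_vars t = {}"
  shows "anchored (\<alpha> + \<Gamma>) u"
  using assms by cases (auto intro: anchored_App)

section \<open>Extending valuations to the bound variables of an instance\<close>

lemma extend_by_generator:
  assumes "valuation \<Sigma> \<rho>" "\<And>g. distinct (fz g)" "\<And>g. map (var_sort \<Sigma>) (fz g) = gen_args \<Sigma> g"
    and "\<And>g. u \<notin> set (fz g)"
  shows "\<exists>g \<in> gens \<Sigma> (var_sort \<Sigma> u). \<exists>\<rho>'. valuation \<Sigma> \<rho>' \<and>
    (\<forall>v. v \<notin> set (fz g) \<longrightarrow> \<rho>' v = \<rho> v) \<and> holds \<rho>' (Eq u (App g (fz g)))"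
proof -
  have "tree_of_sort \<Sigma> (var_sort \<Sigma> u) (\<rho> u)" using assms(1) by (simp add: valuation_def)
  then obtain g ts where g: "gen_sort \<Sigma> g = var_sort \<Sigma> u" "\<rho> u = Node g ts"
    and ts: "list_all2 (tree_of_sort \<Sigma>) (gen_args \<Sigma> g) ts"
    by cases auto
  let ?zs = "fz g"
  have len: "length ?zs = length ts"
    using ts assms(3)[of g] by (metis length_map list_all2_lengthD)
  \<comment> \<open>The root label of the value of \<open>u\<close> selects the instance, and its
    fresh variables receive the children in order.\<close>
  define \<rho>' where "\<rho>' v = (if v \<in> set ?zs then the (map_of (zip ?zs ts) v) else \<rho> v)" for v
  have nth: "\<rho>' (?zs ! i) = ts ! i" if "i < length ts" for i
    using that len assms(2)[of g] by (simp add: \<rho>'_def map_of_zip_nth)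
  have "tree_of_sort \<Sigma> (var_sort \<Sigma> v) (\<rho>' v)" for v
  proof (cases "v \<in> set ?zs")
    case True
    then obtain i where i: "i < length ts" "v = ?zs ! i" by (metis in_set_conv_nth len)
    then have "tree_of_sort \<Sigma> (map (var_sort \<Sigma>) ?zs ! i) (ts ! i)"
      using ts assms(3)[of g] by (simp add: list_all2_conv_all_nth)
    then show ?thesis using i nth len by simp
  next
    case False
    then show ?thesis using assms(1) by (simp add: \<rho>'_def valuation_def)
  qed
  then have "valuation \<Sigma> \<rho>'" by (simp add: valuation_def)
  moreover have "map \<rho>' ?zs = ts"
    using nth len by (intro nth_equalityI) auto
  then have "holds \<rho>' (Eq u (App g ?zs))"
    using g(2) assms(4)[of g] by (simp add: \<rho>'_def)
  moreover have "g \<in> gens \<Sigma> (var_sort \<Sigma> u)" using g(1) by (simp add: gens_def)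
  moreover have "\<forall>v. v \<notin> set ?zs \<longrightarrow> \<rho>' v = \<rho> v" by (simp add: \<rho>'_def)
  ultimately show ?thesis by blast
qed

lemma extend_by_flat:
  assumes "fresh_choice \<Sigma> \<phi> fz fl" "u \<in> all_vars \<phi>" "trm_of_sort \<Sigma> (var_sort \<Sigma> u) t"
    and "fl u t = (zs, \<Gamma>)" "valuation \<Sigma> \<rho>" "\<rho> u = trm_val \<rho> t"
  shows "\<exists>\<rho>'. valuation \<Sigma> \<rho>' \<and> (\<forall>v. v \<notin> set zs \<longrightarrow> \<rho>' v = \<rho> v) \<and> (\<forall>c \<in># \<Gamma>. holds \<rho>' c)"
  using fresh_choice_fl[OF assms(1-4)] assms(2-6)
  by (intro flat_extend(1)[of u t zs \<Gamma> \<Sigma> \<rho>]) auto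

text \<open>The variables \<open>u_s\<close> are set first, since the values of the terms depend on
  them; only then is a term chosen by \<open>T_covers\<close>. The flattening variables avoid the
  \<open>u_s\<close>, so the equations of \<open>U_s\<close> remain true.\<close>

lemma extend_by_flat_with_ueqs:
  assumes adm: "admissible \<Sigma>" and fresh: "fresh_choice \<Sigma> \<phi> fz fl"
    and u: "u \<in> all_vars \<phi>" "uvar \<Sigma> ` S_1I \<Sigma> \<inter> all_vars \<phi> = {}"
    and T: "\<And>t. t \<in> T \<Longrightarrow> trm_of_sort \<Sigma> (var_sort \<Sigma> u) t"
    and val: "valuation \<Sigma> \<rho>"
    and T_covers: "\<And>\<sigma>. \<lbrakk>valuation \<Sigma> \<sigma>; \<forall>r \<in> S_1I \<Sigma>. \<sigma> (uvar \<Sigma> r) \<in> inf_trees \<Sigma> r\<rbrakk> \<Longrightarrow>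
      \<rho> u \<in> trm_val \<sigma> ` T"
  shows "\<exists>zs \<Gamma> \<rho>'. (zs, \<Gamma>) \<in> (\<lambda>t. with_ueqs \<Sigma> (fl u t)) ` T \<and> valuation \<Sigma> \<rho>' \<and>
    (\<forall>v. v \<notin> set zs \<longrightarrow> \<rho>' v = \<rho> v) \<and> (\<forall>c \<in># \<Gamma>. holds \<rho>' c)"
proof -
  obtain \<rho>1 where \<rho>1: "valuation \<Sigma> \<rho>1" "\<And>v. v \<notin> uvar \<Sigma> ` S_1I \<Sigma> \<Longrightarrow> \<rho>1 v = \<rho> v"
    "\<And>s. s \<in> S_1I \<Sigma> \<Longrightarrow> \<rho>1 (uvar \<Sigma> s) \<in> inf_trees \<Sigma> s"
    using extend_to_uvars[OF adm val] by blast
  obtain t where t: "t \<in> T" "\<rho> u = trm_val \<rho>1 t"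
    using T_covers[OF \<rho>1(1)] \<rho>1(3) by blast
  have u1: "\<rho>1 u = trm_val \<rho>1 t" using t(2) \<rho>1(2)[of u] u by auto
  obtain zs \<Gamma> where fl: "fl u t = (zs, \<Gamma>)" by (cases "fl u t")
  obtain \<rho>2 where \<rho>2: "valuation \<Sigma> \<rho>2" "\<And>v. v \<notin> set zs \<Longrightarrow> \<rho>2 v = \<rho>1 v"
    "\<forall>c \<in># \<Gamma>. holds \<rho>2 c"
    using extend_by_flat[OF fresh u(1) T[OF t(1)] fl \<rho>1(1) u1] by blast
  have "set zs \<inter> uvar \<Sigma> ` S_1I \<Sigma> = {}"
    using fresh_choice_fl(4)[OF fresh u(1) T[OF t(1)] fl] by blast
  then have "uvar \<Sigma> s \<notin> set zs" if "s \<in> S_1I \<Sigma>" for s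
    using that by blast
  then have "\<rho>2 (uvar \<Sigma> s) \<in> inf_trees \<Sigma> s" if "s \<in> S_1I \<Sigma>" for s
    using \<rho>1(3) \<rho>2(2) that by simp
  then have "\<forall>s \<in> S_1I \<Sigma>. \<forall>c \<in> ueqs \<Sigma> s. holds \<rho>2 c"
    using admissible_ueqs[OF adm \<rho>2(1)] by blast
  then have "holds \<rho>2 c" if "c \<in># snd (with_ueqs \<Sigma> (zs, \<Gamma>))" for c
    using that \<rho>2(3) set_mset_ueqs[OF adm, of c] unfolding with_ueqs_def by fastforce
  moreover have "\<forall>v. v \<notin> set (fst (with_ueqs \<Sigma> (zs, \<Gamma>))) \<longrightarrow> \<rho>2 v = \<rho> v"
    using \<rho>2(2) \<rho>1(2) by (simp add: with_ueqs_vars[OF adm])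
  moreover have "with_ueqs \<Sigma> (zs, \<Gamma>) \<in> (\<lambda>t. with_ueqs \<Sigma> (fl u t)) ` T"
    using t(1) fl by (metis imageI)
  ultimately show ?thesis
    using \<rho>2(1) by (metis prod.collapse)
qed

section \<open>Case distinction on the output of the procedure\<close>

lemma find_inst_in_None:
  "find_inst_in \<Sigma> fz fl \<phi> us = None \<Longrightarrow> u \<in> set us \<Longrightarrow>
    \<not> inst_gen \<Sigma> \<phi> u \<and> \<not> inst_all \<Sigma> \<phi> u \<and> \<not> inst_fin \<Sigma> \<phi> u \<and> \<not> inst_inf \<Sigma> \<phi> u"
  by (induction us) (auto simp: Let_def split: if_splits)

text \<open>The last case also records failed tests: the instance \<open>Fin u\<close> is handled
  through the failure of \<open>inst_gen\<close> and \<open>inst_all\<close>.\<close>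

lemma find_inst_in_Some:
  assumes "find_inst_in \<Sigma> fz fl \<phi> us = Some (u, I)"
  obtains (gen) "inst_gen \<Sigma> \<phi> u" "u \<in> set us"
      "I = (\<lambda>g. (fz g, {# Eq u (App g (fz g)) #})) ` gens \<Sigma> (var_sort \<Sigma> u)"
    | (all) "inst_all \<Sigma> \<phi> u" "u \<in> set us"
      "I = (\<lambda>t. with_ueqs \<Sigma> (fl u t)) ` (fin_terms \<Sigma> (var_sort \<Sigma> u) \<union> inf_terms \<Sigma> (var_sort \<Sigma> u))"
    | (fin) "inst_fin \<Sigma> \<phi> u" "u \<in> set us" "I = fl u ` fin_terms \<Sigma> (var_sort \<Sigma> u)"
    | (inf) "\<not> inst_gen \<Sigma> \<phi> u" "\<not> inst_all \<Sigma> \<phi> u" "inst_inf \<Sigma> \<phi> u" "u \<in> set us"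
      "I = insert ([], {# Fin u #})
        ((\<lambda>t. with_ueqs \<Sigma> (fl u t)) ` inf_terms \<Sigma> (var_sort \<Sigma> u))"
  using assms
proof (induction us arbitrary: thesis)
  case (Cons w us)
  consider "inst_gen \<Sigma> \<phi> w" | "\<not> inst_gen \<Sigma> \<phi> w" "inst_all \<Sigma> \<phi> w"
    | "\<not> inst_gen \<Sigma> \<phi> w" "\<not> inst_all \<Sigma> \<phi> w" "inst_fin \<Sigma> \<phi> w"
    | "\<not> inst_gen \<Sigma> \<phi> w" "\<not> inst_all \<Sigma> \<phi> w" "\<not> inst_fin \<Sigma> \<phi> w" "inst_inf \<Sigma> \<phi> w"
    | "\<not> inst_gen \<Sigma> \<phi> w" "\<not> inst_all \<Sigma> \<phi> w" "\<not> inst_fin \<Sigma> \<phi> w" "\<not> inst_inf \<Sigma> \<phi> w"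
    by blast
  then show thesis
  proof cases
    case 1
    with Cons.prems(5) show ?thesis by (intro Cons.prems(1)) (auto simp: Let_def)
  next
    case 2
    with Cons.prems(5) show ?thesis by (intro Cons.prems(2)) (auto simp: Let_def)
  next
    case 3
    with Cons.prems(5) show ?thesis by (intro Cons.prems(3)) (auto simp: Let_def)
  next
    case 4
    with Cons.prems(5) show ?thesis by (intro Cons.prems(4)) (auto simp: Let_def)
  next
    case 5
    with Cons.prems(5) have "find_inst_in \<Sigma> fz fl \<phi> us = Some (u, I)" by (simp add: Let_def)
    then show ?thesis
      by (rule Cons.IH[rotated 4]) (auto intro: Cons.prems(1-4))
  qed
qed simp

text \<open>Reduces the four kinds of instantiation to a covering property and non-instantiability
  of each instance. Anchored instances need no further argument; the second alternative of
  \<open>not_inst\<close> is meant for \<open>Fin u\<close>.\<close>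

lemma correct_instantiation:
  fixes \<Sigma> :: "('s, 'g, 'v::linorder) signature"
  assumes ws: "well_sorted \<Sigma> \<phi>"
    and fresh: "\<And>zs \<psi>. (zs, \<psi>) \<in> I \<Longrightarrow> set zs \<inter> all_vars \<phi> = {}"
    and ws': "\<And>zs \<psi>. (zs, \<psi>) \<in> I \<Longrightarrow> well_sorted_basic \<Sigma> \<psi>"
    and cover: "\<And>\<sigma>. \<lbrakk>valuation \<Sigma> \<sigma>; \<forall>c \<in># nbasic \<phi>. holds \<sigma> c\<rbrakk> \<Longrightarrow>
      \<exists>zs \<psi> \<sigma>'. (zs, \<psi>) \<in> I \<and> valuation \<Sigma> \<sigma>' \<and> (\<forall>v. v \<notin> set zs \<longrightarrow> \<sigma>' v = \<sigma> v) \<and>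
        (\<forall>c \<in># \<psi>. holds \<sigma>' c)"
    and not_inst: "\<And>zs \<psi> \<phi>'. (zs, \<psi>) \<in> I \<Longrightarrow>
      anchored (nbasic \<phi> + \<psi>) u \<or>
      (solved_form \<Sigma> u (instantiate \<phi> (zs, \<psi>)) \<phi>' \<longrightarrow> \<not> instantiable \<Sigma> \<phi>' u)"
  shows "(\<forall>\<rho>. valuation \<Sigma> \<rho> \<longrightarrow>
       (models \<Sigma> \<rho> \<phi> \<longleftrightarrow> (\<forall>\<psi> \<in> I. models \<Sigma> \<rho> (instantiate \<phi> \<psi>)))) \<and>
     (\<forall>\<psi> \<in> I. well_sorted \<Sigma> (instantiate \<phi> \<psi>) \<and>
       no_longer_instantiable \<Sigma> u (instantiate \<phi> \<psi>))"
proof (intro conjI allI impI ballI)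
  fix \<rho> assume "valuation \<Sigma> \<rho>"
  then show "models \<Sigma> \<rho> \<phi> \<longleftrightarrow> (\<forall>\<psi> \<in> I. models \<Sigma> \<rho> (instantiate \<phi> \<psi>))"
    using fresh cover by (rule models_instantiate_iff)
next
  fix p assume "p \<in> I"
  then obtain zs \<psi> where p: "p = (zs, \<psi>)" "(zs, \<psi>) \<in> I" by (cases p) auto
  obtain xs \<alpha> \<phi>s where \<phi>: "\<phi> = NegEx xs \<alpha> \<phi>s" by (cases \<phi>)
  show "well_sorted \<Sigma> (instantiate \<phi> p)"
    using ws ws'[OF p(2)] by (simp add: p(1) \<phi> instantiate_def)
  have "\<not> instantiable \<Sigma> \<phi>' u" if "solved_form \<Sigma> u (instantiate \<phi> p) \<phi>'" for \<phi>'
    using not_inst[OF p(2), of \<phi>'] that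
      solved_form_anchored_not_instantiable[of \<Sigma> u "xs @ zs" "\<alpha> + \<psi>" \<phi>s \<phi>']
    by (auto simp: p(1) \<phi> instantiate_def)
  then show "no_longer_instantiable \<Sigma> u (instantiate \<phi> p)"
    using solved_form_exists[of \<Sigma> "\<alpha> + \<psi>"]
    by (auto simp: no_longer_instantiable_def p(1) \<phi> instantiate_def)
qed

theorem theorem9:
  fixes \<Sigma> :: "('s, 'g, 'v::linorder) signature"
    and \<phi> :: "('g, 'v) normal"
    and vs :: "'v list"
    and fz :: "'g \<Rightarrow> 'v list"
    and fl :: "'v \<Rightarrow> ('g, 'v) trm \<Rightarrow> 'v list \<times> ('g, 'v) basic"
  assumes "admissible \<Sigma>"
    and "well_sorted \<Sigma> \<phi>"
    and "depth \<phi> \<le> 2"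
    and "distinct vs" and "set vs = free_vars \<phi>"
    and "solved \<Sigma> (nbasic \<phi>)" and "\<forall>\<chi> \<in> set (nsubs \<phi>). solved \<Sigma> (nbasic \<chi>)"
    and "uvar \<Sigma> ` S_1I \<Sigma> \<inter> all_vars \<phi> = {}"
    and "fresh_choice \<Sigma> \<phi> fz fl"
  shows "case find_instantiation \<Sigma> fz fl vs \<phi> of
      None \<Rightarrow> (\<nexists>v. instantiable \<Sigma> \<phi> v)
    | Some (u, I) \<Rightarrow>
        finite I \<and>
        (\<forall>\<rho>. valuation \<Sigma> \<rho> \<longrightarrow>
           (models \<Sigma> \<rho> \<phi> \<longleftrightarrow> (\<forall>\<psi> \<in> I. models \<Sigma> \<rho> (instantiate \<phi> \<psi>)))) \<and>
        (\<forall>\<psi> \<in> I. well_sorted \<Sigma> (instantiate \<phi> \<psi>) \<and>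
           no_longer_instantiable \<Sigma> u (instantiate \<phi> \<psi>))"
proof (cases "find_instantiation \<Sigma> fz fl vs \<phi>")
  case None
  then have "\<not> instantiable \<Sigma> \<phi> v" for v
    using find_inst_in_None[of \<Sigma> fz fl \<phi> "vs @ nvars \<phi>" v] assms(5)
    by (auto simp: find_instantiation_def instantiable_def)
  then show ?thesis using None by simp
next
  case (Some p)
  then obtain u I where p: "p = (u, I)" "find_inst_in \<Sigma> fz fl \<phi> (vs @ nvars \<phi>) = Some (u, I)"
    by (cases p) (simp add: find_instantiation_def)
  let ?s = "var_sort \<Sigma> u"
  note adm = assms(1) and fresh = assms(9) and ufresh = assms(8)
  have all_vars: "set (vs @ nvars \<phi>) \<subseteq> all_vars \<phi>"
    using assms(5) free_vars_subset_all_vars[of \<phi>] by (cases \<phi>) auto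
  have flat_facts: "set zs \<inter> all_vars \<phi> = {} \<and> well_sorted_basic \<Sigma> \<psi> \<and> flat u t zs \<psi>"
    if "u \<in> all_vars \<phi>" "trm_of_sort \<Sigma> ?s t" "(zs, \<psi>) = fl u t" for t zs \<psi>
    using fresh_choice_fl[OF fresh that(1,2) that(3)[symmetric]] by blast
  have ueqs_facts: "set zs \<inter> all_vars \<phi> = {} \<and> well_sorted_basic \<Sigma> \<psi> \<and> anchored (nbasic \<phi> + \<psi>) u"
    if "u \<in> all_vars \<phi>" "trm_of_sort \<Sigma> ?s t" "(zs, \<psi>) = with_ueqs \<Sigma> (fl u t)"
      "trm_vars t \<subseteq> uvar \<Sigma> ` S_1I \<Sigma>" for t zs \<psi>
  proof -
    obtain zs' \<Gamma> where fl: "(zs', \<Gamma>) = fl u t" by (metis surj_pair)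
    then have eq: "zs = fst (with_ueqs \<Sigma> (zs', \<Gamma>))" "\<psi> = snd (with_ueqs \<Sigma> (zs', \<Gamma>))"
      using that(3) by (metis fst_conv, metis snd_conv)
    have "well_sorted_basic \<Sigma> (\<Sum>s \<leftarrow> one_inf \<Sigma>. mset_set (ueqs \<Sigma> s))"
      using set_mset_ueqs[OF adm] admissible_uvar(3)[OF adm]
      by (auto simp: well_sorted_basic_def)
    then have "well_sorted_basic \<Sigma> \<psi>"
      using flat_facts[OF that(1,2) fl] by (simp add: eq(2) with_ueqs_def)
    moreover have "set zs \<inter> all_vars \<phi> = {}"
      using flat_facts[OF that(1,2) fl] ufresh by (auto simp: eq(1) with_ueqs_vars[OF adm])
    moreover have "anchored (nbasic \<phi> + \<psi>) u"
      using anchored_flat_with_ueqs[OF adm _ that(4)] flat_facts[OF that(1,2) fl] eq(2) by blast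
    ultimately show ?thesis by blast
  qed
  have u: "u \<in> all_vars \<phi>"
    using p(2) by (cases rule: find_inst_in_Some) (use all_vars in auto)
  have "finite I \<and> (\<forall>\<rho>. valuation \<Sigma> \<rho> \<longrightarrow>
       (models \<Sigma> \<rho> \<phi> \<longleftrightarrow> (\<forall>\<psi> \<in> I. models \<Sigma> \<rho> (instantiate \<phi> \<psi>)))) \<and>
     (\<forall>\<psi> \<in> I. well_sorted \<Sigma> (instantiate \<phi> \<psi>) \<and>
       no_longer_instantiable \<Sigma> u (instantiate \<phi> \<psi>))"
    using p(2)
  proof (cases rule: find_inst_in_Some)
    case gen
    note fz = fresh_choice_fz[OF fresh]
    have "finite I" using gen by (simp add: inst_gen_def)
    moreover have "\<exists>zs \<psi> \<sigma>'. (zs, \<psi>) \<in> I \<and> valuation \<Sigma> \<sigma>' \<and> (\<forall>v. v \<notin> set zs \<longrightarrow> \<sigma>' v = \<sigma> v) \<and>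
        (\<forall>c \<in># \<psi>. holds \<sigma>' c)" if "valuation \<Sigma> \<sigma>" for \<sigma>
    proof -
      have "u \<notin> set (fz g)" for g using fz(3)[of g] u by blast
      from extend_by_generator[of \<Sigma> \<sigma> fz u, OF that fz(1,2) this] obtain g \<sigma>'
        where "g \<in> gens \<Sigma> ?s" "valuation \<Sigma> \<sigma>'" "\<forall>v. v \<notin> set (fz g) \<longrightarrow> \<sigma>' v = \<sigma> v"
          "holds \<sigma>' (Eq u (App g (fz g)))" by blast
      then show ?thesis
        unfolding gen(3)
        by (intro exI[of _ "fz g"] exI[of _ "{# Eq u (App g (fz g)) #}"] exI[of _ \<sigma>']) auto
    qed
    moreover have "set zs \<inter> all_vars \<phi> = {}" "well_sorted_basic \<Sigma> \<psi>" "anchored (nbasic \<phi> + \<psi>) u"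
      if "(zs, \<psi>) \<in> I" for zs \<psi>
    proof -
      from that obtain g where "g \<in> gens \<Sigma> ?s" "zs = fz g" "\<psi> = {# Eq u (App g (fz g)) #}"
        unfolding gen(3) by blast
      then show "set zs \<inter> all_vars \<phi> = {}" "well_sorted_basic \<Sigma> \<psi>" "anchored (nbasic \<phi> + \<psi>) u"
        using fz by (auto simp: gens_def intro: anchored_App)
    qed
    ultimately show ?thesis
      by (intro conjI[OF _ correct_instantiation[OF assms(2)]]) blast+
  next
    case all
    then have s: "?s \<in> S_FF \<Sigma>" "?s \<in> S_FI \<Sigma>" by (auto simp: inst_all_def)
    note ft = admissible_fin_terms[OF adm s(1)] and it = admissible_inf_terms[OF adm s(2)]
    let ?T = "fin_terms \<Sigma> ?s \<union> inf_terms \<Sigma> ?s"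
    have "finite I" using all(3) ft(1) it(1) by simp
    moreover have "\<exists>zs \<psi> \<sigma>'. (zs, \<psi>) \<in> I \<and> valuation \<Sigma> \<sigma>' \<and> (\<forall>v. v \<notin> set zs \<longrightarrow> \<sigma>' v = \<sigma> v) \<and>
        (\<forall>c \<in># \<psi>. holds \<sigma>' c)" if val: "valuation \<Sigma> \<sigma>" for \<sigma>
      unfolding all(3)
    proof (rule extend_by_flat_with_ueqs[OF adm fresh u ufresh _ val])
      fix \<rho> assume \<rho>: "valuation \<Sigma> \<rho>" "\<forall>r \<in> S_1I \<Sigma>. \<rho> (uvar \<Sigma> r) \<in> inf_trees \<Sigma> r"
      \<comment> \<open>Every tree is finite or infinite, and the two sets of terms exhaust the
        trees of either kind.\<close>
      have "\<sigma> u \<in> fin_trees \<Sigma> ?s \<union> inf_trees \<Sigma> ?s"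
        using val by (auto simp: valuation_def fin_trees_def inf_trees_def)
      then show "\<sigma> u \<in> trm_val \<rho> ` ?T"
        unfolding image_Un ft(4)[OF \<rho>(1)] it(4)[OF \<rho>] .
    qed (use ft(2) it(2) in blast)
    moreover have "set zs \<inter> all_vars \<phi> = {} \<and> well_sorted_basic \<Sigma> \<psi> \<and> anchored (nbasic \<phi> + \<psi>) u"
      if "(zs, \<psi>) \<in> I" for zs \<psi>
    proof -
      from that obtain t where "t \<in> ?T" "(zs, \<psi>) = with_ueqs \<Sigma> (fl u t)"
        unfolding all(3) by blast
      then show ?thesis
        using ft(2,3)[of t] it(2,3)[of t] by (intro ueqs_facts[OF u]) blast+
    qed
    ultimately show ?thesis
      by (intro conjI[OF _ correct_instantiation[OF assms(2)]]) blast+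
  next
    case fin
    then have s: "?s \<in> S_FF \<Sigma>" and Fin: "Fin u \<in># nbasic \<phi>" by (auto simp: inst_fin_def)
    note ft = admissible_fin_terms[OF adm s(1)]
    have "finite I" using fin(3) ft(1) by simp
    moreover have "\<exists>zs \<psi> \<sigma>'. (zs, \<psi>) \<in> I \<and> valuation \<Sigma> \<sigma>' \<and> (\<forall>v. v \<notin> set zs \<longrightarrow> \<sigma>' v = \<sigma> v) \<and>
        (\<forall>c \<in># \<psi>. holds \<sigma>' c)" if \<sigma>: "valuation \<Sigma> \<sigma>" "\<forall>c \<in># nbasic \<phi>. holds \<sigma> c" for \<sigma>
    proof -
      \<comment> \<open>The ground terms cover only finite trees; this is where the covering
        property relies on the conjuncts of \<alpha>.\<close>
      have "holds \<sigma> (Fin u)" using Fin \<sigma>(2) by blast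
      then have "\<sigma> u \<in> fin_trees \<Sigma> ?s" using \<sigma>(1) by (simp add: fin_trees_def valuation_def)
      then obtain t where t: "t \<in> fin_terms \<Sigma> ?s" "\<sigma> u = trm_val \<sigma> t"
        using ft(4)[OF \<sigma>(1)] by blast
      obtain zs \<psi> where fl: "fl u t = (zs, \<psi>)" by (cases "fl u t")
      then have "(zs, \<psi>) \<in> I" using t(1) fin(3) by (metis imageI)
      then show ?thesis
        using extend_by_flat[OF fresh u ft(2)[OF t(1)] fl \<sigma>(1) t(2)] by blast
    qed
    moreover have "set zs \<inter> all_vars \<phi> = {} \<and> well_sorted_basic \<Sigma> \<psi> \<and> anchored (nbasic \<phi> + \<psi>) u"
      if "(zs, \<psi>) \<in> I" for zs \<psi>
    proof -
      from that obtain t where "t \<in> fin_terms \<Sigma> ?s" "(zs, \<psi>) = fl u t"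
        unfolding fin(3) by blast
      then show ?thesis
        using flat_facts[OF u ft(2)] anchored_flat_ground[OF _ ft(3)] by blast
    qed
    ultimately show ?thesis
      by (intro conjI[OF _ correct_instantiation[OF assms(2)]]) blast+
  next
    case inf
    then have s: "?s \<in> S_FI \<Sigma>" by (auto simp: inst_inf_def)
    note it = admissible_inf_terms[OF adm s]
    have "finite I" using inf(5) it(1) by simp
    moreover have "\<exists>zs \<psi> \<sigma>'. (zs, \<psi>) \<in> I \<and> valuation \<Sigma> \<sigma>' \<and> (\<forall>v. v \<notin> set zs \<longrightarrow> \<sigma>' v = \<sigma> v) \<and>
        (\<forall>c \<in># \<psi>. holds \<sigma>' c)" if val: "valuation \<Sigma> \<sigma>" for \<sigma>
    \<comment> \<open>Finite values are covered by the instance \<open>Fin u\<close>, which binds no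
      variables, and infinite ones by the terms.\<close>
    proof (cases "fin_tree (\<sigma> u)")
      case True
      then show ?thesis
        using val unfolding inf(5)
        by (intro exI[of _ "[]"] exI[of _ "{# Fin u #}"] exI[of _ \<sigma>]) auto
    next
      case False
      then have "\<sigma> u \<in> inf_trees \<Sigma> ?s" using val by (simp add: valuation_def inf_trees_def)
      then have "\<exists>zs \<psi> \<sigma>'. (zs, \<psi>) \<in> (\<lambda>t. with_ueqs \<Sigma> (fl u t)) ` inf_terms \<Sigma> ?s \<and>
          valuation \<Sigma> \<sigma>' \<and> (\<forall>v. v \<notin> set zs \<longrightarrow> \<sigma>' v = \<sigma> v) \<and> (\<forall>c \<in># \<psi>. holds \<sigma>' c)"
        using it(2,4) by (intro extend_by_flat_with_ueqs[OF adm fresh u ufresh _ val]) blast+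
      then show ?thesis unfolding inf(5) by blast
    qed
    moreover have "set zs \<inter> all_vars \<phi> = {} \<and> well_sorted_basic \<Sigma> \<psi> \<and>
        (anchored (nbasic \<phi> + \<psi>) u \<or>
         (solved_form \<Sigma> u (instantiate \<phi> (zs, \<psi>)) \<phi>' \<longrightarrow> \<not> instantiable \<Sigma> \<phi>' u))"
      if "(zs, \<psi>) \<in> I" for zs \<psi> \<phi>'
    proof -
      from that consider "zs = []" "\<psi> = {# Fin u #}"
        | t where "t \<in> inf_terms \<Sigma> ?s" "(zs, \<psi>) = with_ueqs \<Sigma> (fl u t)"
        unfolding inf(5) by blast
      then show ?thesis
      proof cases
        case 1
        \<comment> \<open>The one instance that need not be anchored; it requires the failure of the
          tests tried earlier.\<close>
        obtain xs \<alpha> \<phi>s where \<phi>: "\<phi> = NegEx xs \<alpha> \<phi>s" by (cases \<phi>)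
        then show ?thesis
          using 1 solved_form_Fin_not_instantiable[of \<Sigma> u xs \<alpha> \<phi>s \<phi>'] inf(1-3) assms(6,7)
          by (auto simp: instantiate_def)
      next
        case 2
        then show ?thesis using ueqs_facts[OF u it(2) 2(2) it(3)] by blast
      qed
    qed
    ultimately show ?thesis
      by (intro conjI[OF _ correct_instantiation[OF assms(2)]]) blast+
  qed
  then show ?thesis using Some p(1) by simp
qed

end
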